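(* Let $w\in A_\infty$ be a Muckenhoupt weight on $\mathbb{R}^n$. Then there exist constants $C_{w,n},c_{w,n}>0$, depending only upon $n$ and $w$, such that \[ \mathsf{C}_w(\alpha)-1\le C_{w,n}(1-\alpha)^{c_{w,n}} \] as $\alpha\to 1^-$ (i.e. for all $\alpha<1$ sufficiently close to $1$).
   Context: All cubes are cubes in $\mathbb{R}^n$ with sides parallel to the coordinate axes. A weight is a non-negative locally integrable function $w$ on $\mathbb{R}^n$, and $w(E)=\int_E w$. $A_\infty$ is the class of weights with finite Fujii–Wilson constant $[w]_{A_\infty}=\sup_Q \frac{1}{w(Q)}\int_Q \mathsf{M}(w\chi_Q)$, where $\mathsf{M}$ is the uncentered Hardy–Littlewood maximal operator with respect to Lebesgue measure over cubes; equivalently $A_\infty=\bigcup_{p\ge1}A_p$. The weighted maximal operator is $\mathsf{M}_w f(x)=\sup_{Q\ni x}\frac{1}{w(Q)}\int_Q|f|w$, the supremum over all cubes containing $x$. The sharp Tauberian constant is \[ \mathsf{C}_w(\alpha)=\sup_{E:\,0<w(E)<\infty} w(E)^{-1}\,w(\{x\in\mathbb{R}^n:\ \mathsf{M}_w\chi_E(x)>\alpha\}),\quad \alpha\in(0,1). \] *)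

theory Defs
  imports "HOL-Analysis.Analysis"
begin

definition is_cube :: "'a::euclidean_space set \<Rightarrow> bool" where
  "is_cube Q \<longleftrightarrow> (\<exists>a l. l > 0 \<and> Q = box a (a + l *\<^sub>R One))"

definition is_weight :: "('a::euclidean_space \<Rightarrow> real) \<Rightarrow> bool" where
  "is_weight w \<longleftrightarrow> (\<forall>x. 0 \<le> w x) \<and> (\<forall>K. compact K \<longrightarrow> set_integrable lebesgue K w)"

definition wmeas :: "('a::euclidean_space \<Rightarrow> real) \<Rightarrow> 'a set \<Rightarrow> ennreal" where
  "wmeas w E = (\<integral>\<^sup>+ x\<in>E. ennreal (w x) \<partial>lebesgue)"

definition maxop :: "('a::euclidean_space \<Rightarrow> real) \<Rightarrow> 'a \<Rightarrow> ennreal" where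
  "maxop f x = (SUP Q \<in> {Q. is_cube Q \<and> x \<in> Q}.
      (\<integral>\<^sup>+ y\<in>Q. ennreal \<bar>f y\<bar> \<partial>lebesgue) / emeasure lebesgue Q)"

definition Ainf_const :: "('a::euclidean_space \<Rightarrow> real) \<Rightarrow> ennreal" where
  "Ainf_const w = (SUP Q \<in> {Q. is_cube Q}.
      (\<integral>\<^sup>+ x\<in>Q. maxop (\<lambda>y. w y * indicator Q y) x \<partial>lebesgue) / wmeas w Q)"

definition A_infty :: "('a::euclidean_space \<Rightarrow> real) set" where
  "A_infty = {w. is_weight w \<and> Ainf_const w < \<infinity>}"

definition wmaxop :: "('a::euclidean_space \<Rightarrow> real) \<Rightarrow> ('a \<Rightarrow> real) \<Rightarrow> 'a \<Rightarrow> ennreal" where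
  "wmaxop w f x = (SUP Q \<in> {Q. is_cube Q \<and> x \<in> Q}.
      (\<integral>\<^sup>+ y\<in>Q. ennreal (\<bar>f y\<bar> * w y) \<partial>lebesgue) / wmeas w Q)"

definition tauberian :: "('a::euclidean_space \<Rightarrow> real) \<Rightarrow> real \<Rightarrow> ennreal" where
  "tauberian w \<alpha> = (SUP E \<in> {E \<in> sets lebesgue. 0 < wmeas w E \<and> wmeas w E < \<infinity>}.
      wmeas w {x. ennreal \<alpha> < wmaxop w (indicator E) x} / wmeas w E)"

end

theory Submission
  imports Defs
begin

text \<open>
  Let \<open>W\<close> be the measure with density \<open>w\<close>, and let \<open>Q\<close> range over the cubes with
  \<open>W (Q - E) \<le> (1 - \<alpha>) W Q\<close>. Shrink every \<open>Q\<close> about its centre by a factor \<open>1 - s\<close>.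
  The shrunken cubes are covered by balls of size \<open>s\<close> times the side of \<open>Q\<close> that stay inside \<open>Q\<close>;
  by doubling, \<open>E\<close> misses at most the proportion \<open>(1 - \<alpha>) s\<^sup>-\<^sup>D\<close> of each of them, and Vitali's lemma
  adds this up. What the shrunken cubes leave uncovered has small Lebesgue measure, because
  the union of the shrunken cubes has at least \<open>(1 - s)\<^sup>n\<close> times the measure of the union of the cubes.
  A second Vitali argument makes this local, and \<open>A\<^sub>\<infinity>\<close> turns it into smallness of order \<open>s\<^sup>c\<close>
  for \<open>W\<close>. It remains to take \<open>s\<close> to be a small power of \<open>1 - \<alpha>\<close>.

  The power bound for \<open>W\<close> comes from the Fujii-Wilson condition: if \<open>\<Omega> j\<close> is the set where the dyadic
  maximal function of \<open>w\<close> on a cube exceeds \<open>2\<^sup>j\<close> times the mean of \<open>w\<close>, then the stopping cubes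
  give \<open>\<Sum>i\<ge>j. 2\<^sup>i |\<Omega> i| \<le> K 2\<^sup>j |\<Omega> j|\<close>, and such tail sums decay geometrically.
\<close>

section \<open>Cubes\<close>

text \<open>Centre and half-side with the sup norm: inclusions become triangle inequalities, and
  shrinking about the centre only scales \<open>r\<close>. For \<open>r \<le> 0\<close> the set is
  empty, which covers the shrinking factor 0.\<close>

definition open_cube :: "'a::euclidean_space \<Rightarrow> real \<Rightarrow> 'a set" where
  "open_cube c r = {x. infnorm (x - c) < r}"

lemma infnorm_less_iff: "infnorm (x::'a::euclidean_space) < r \<longleftrightarrow> (\<forall>b\<in>Basis. \<bar>x \<bullet> b\<bar> < r)"
  unfolding infnorm_Max by (subst Max_less_iff) auto

lemma open_cube_eq_box: "open_cube c r = box (c - r *\<^sub>R One) (c + r *\<^sub>R One)"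
  unfolding open_cube_def infnorm_less_iff box_def
  by (auto simp: inner_diff_left inner_add_left abs_less_iff algebra_simps)

lemma open_cube_open [simp]: "open (open_cube c r)"
  unfolding open_cube_eq_box by (rule open_box)

lemma open_cube_sets [measurable]: "open_cube c r \<in> sets borel" "open_cube c r \<in> sets lebesgue"
  using open_cube_open[of c r] by auto

lemma emeasure_open_cube:
  assumes "r \<ge> 0"
  shows "emeasure lebesgue (open_cube (c::'a::euclidean_space) r) = ennreal ((2*r) ^ DIM('a))"
    and "emeasure lborel (open_cube c r) = ennreal ((2*r) ^ DIM('a))"
  using assms
  unfolding open_cube_eq_box
  by (simp_all add: emeasure_completion emeasure_lborel_box inner_diff_left inner_add_left del: mult_2)

lemma is_cube_iff_open_cube: "is_cube Q \<longleftrightarrow> (\<exists>c r. r > 0 \<and> Q = open_cube c r)"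
proof
  assume "is_cube Q"
  then obtain a l where Q: "l > 0" "Q = box a (a + l *\<^sub>R One)" by (auto simp: is_cube_def)
  have "a = (a + (l/2) *\<^sub>R One) - (l/2) *\<^sub>R One" "a + l *\<^sub>R One = (a + (l/2) *\<^sub>R One) + (l/2) *\<^sub>R One"
    unfolding add.assoc scaleR_add_left[symmetric] by simp_all
  then have "Q = open_cube (a + (l/2) *\<^sub>R One) (l/2)"
    unfolding open_cube_eq_box using Q by metis
  with \<open>l > 0\<close> show "\<exists>c r. r > 0 \<and> Q = open_cube c r" by (metis half_gt_zero)
next
  assume "\<exists>c r. r > 0 \<and> Q = open_cube c r"
  then obtain c r where Q: "r > 0" "Q = open_cube c r" by auto
  have "c + r *\<^sub>R One = (c - r *\<^sub>R One) + (r + r) *\<^sub>R One"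
    unfolding scaleR_add_left by simp
  then have "Q = box (c - r *\<^sub>R One) ((c - r *\<^sub>R One) + (r + r) *\<^sub>R One)"
    using Q unfolding open_cube_eq_box by metis
  then show "is_cube Q"
    unfolding is_cube_def using Q by (intro exI[of _ "c - r *\<^sub>R One"] exI[of _ "r + r"] conjI) linarith+
qed

lemma open_cube_subset: "infnorm (c - d) \<le> s - r \<Longrightarrow> open_cube c r \<subseteq> open_cube d s"
proof
  fix x assume "infnorm (c - d) \<le> s - r" "x \<in> open_cube c r"
  moreover have "x - d = (x - c) + (c - d)" by simp
  then have "infnorm (x - d) \<le> infnorm (x - c) + infnorm (c - d)"
    by (metis infnorm_triangle)
  ultimately show "x \<in> open_cube d s" by (simp add: open_cube_def)
qed

lemma open_cube_subset_ball: "open_cube (c::'a::euclidean_space) r \<subseteq> ball c (sqrt DIM('a) * r)"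
proof
  fix x assume "x \<in> open_cube c r"
  then have "norm (x - c) \<le> sqrt DIM('a) * infnorm (x - c)" "infnorm (x - c) < r"
    by (auto simp: open_cube_def norm_le_infnorm)
  then have "norm (x - c) < sqrt DIM('a) * r"
    by (smt (verit) DIM_positive mult_less_cancel_left_pos of_nat_0_less_iff real_sqrt_gt_0_iff)
  then show "x \<in> ball c (sqrt DIM('a) * r)" by (simp add: dist_norm norm_minus_commute)
qed

lemma ball_subset_open_cube: "ball c r \<subseteq> open_cube c r"
proof
  fix x assume "x \<in> ball c r"
  then show "x \<in> open_cube c r"
    using infnorm_le_norm[of "x - c"] by (simp add: open_cube_def dist_norm norm_minus_commute)
qed

text \<open>
  The cells \<open>V j\<close> of the additively weighted Voronoi diagram are star-shaped about
  \<open>c j\<close> (this fails for multiplicative weights), and within \<open>V j\<close> the union is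
  just the \<open>j\<close>-th cube. So shrinking can be estimated cell by cell. Ties are broken by an
  enumeration \<open>f\<close>.
\<close>

lemma shrink_cubes_lebesgue:
  fixes c :: "'i \<Rightarrow> 'a::euclidean_space"
  assumes I: "finite I" and t: "0 < t" "t \<le> 1"
  shows "ennreal (t ^ DIM('a)) * emeasure lebesgue (\<Union>i\<in>I. open_cube (c i) (r i))
      \<le> emeasure lebesgue (\<Union>i\<in>I. open_cube (c i) (t * r i))"
proof -
  obtain f :: "'i \<Rightarrow> nat" where f: "inj_on f I"
    using finite_imp_inj_to_nat_seg[OF I] by blast
  define h where "h i x = infnorm (x - c i) - r i" for i x
  define V where "V j = {x. \<forall>i\<in>I. h j x < h i x \<or> (h j x = h i x \<and> f j \<le> f i)}" for j
  have hm[measurable]: "h i \<in> borel_measurable borel" for i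
    unfolding h_def by (intro borel_measurable_continuous_onI continuous_intros)
  have Vm[measurable]: "V j \<in> sets borel" for j
    unfolding V_def using I by measurable
  have Vex: "\<exists>j\<in>I. x \<in> V j \<and> h j x \<le> h i x" if i: "i \<in> I" for i x
  proof -
    define m where "m = Min ((\<lambda>j. h j x) ` I)"
    define J where "J = {j\<in>I. h j x = m}"
    have "m \<in> (\<lambda>j. h j x) ` I" unfolding m_def using i I by (intro Min_in) auto
    then have "J \<noteq> {}" by (auto simp: J_def)
    then obtain j where j: "j \<in> J" "\<And>k. k \<in> J \<Longrightarrow> f j \<le> f k"
      using ex_has_least_nat[of "\<lambda>j. j \<in> J" _ f] by blast
    have le: "m \<le> h k x" if "k \<in> I" for k unfolding m_def using that I by auto
    have "x \<in> V j" unfolding V_def using j le by (force simp: J_def)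
    with j i le show ?thesis by (auto simp: J_def)
  qed
  have disj: "disjoint_family_on V I"
    unfolding disjoint_family_on_def V_def using f by (fastforce simp: inj_on_def)
  define T where "T j = (\<lambda>x. t *\<^sub>R x + (1 - t) *\<^sub>R c j)" for j
  have TV: "T j x \<in> V j" if "x \<in> V j" for j x
  proof -
    \<comment> \<open>Moving towards \<open>c j\<close> lowers \<open>h j\<close> by the full
      sup-norm length of the move, and no other \<open>h i\<close> can drop by more.\<close>
    have mono: "h i (T j x) - h j (T j x) \<ge> h i x - h j x" for i
    proof -
      have "T j x - c j = t *\<^sub>R (x - c j)" by (simp add: T_def algebra_simps)
      then have "infnorm (T j x - c j) = t * infnorm (x - c j)" using t by (simp add: infnorm_mul)
      moreover have "infnorm (x - c i) \<le> infnorm (T j x - c i) + (1 - t) * infnorm (x - c j)"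
      proof -
        have e: "x - c i = (T j x - c i) + (1 - t) *\<^sub>R (x - c j)" by (simp add: T_def algebra_simps)
        have "infnorm (x - c i) \<le> infnorm (T j x - c i) + infnorm ((1 - t) *\<^sub>R (x - c j))"
          unfolding e by (rule infnorm_triangle)
        with t show ?thesis by (simp add: infnorm_mul)
      qed
      ultimately show ?thesis unfolding h_def by (simp add: algebra_simps)
    qed
    have "h j (T j x) < h i (T j x) \<or> h j (T j x) = h i (T j x) \<and> f j \<le> f i" if "i \<in> I" for i
      using mono[of i] \<open>x \<in> V j\<close> that unfolding V_def by fastforce
    then show ?thesis unfolding V_def by simp
  qed
  have Tcb: "T j x \<in> open_cube (c j) (t * r j)" if "x \<in> open_cube (c j) (r j)" for j x
  proof -
    have "T j x - c j = t *\<^sub>R (x - c j)" by (simp add: T_def algebra_simps)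
    then show ?thesis using that t by (simp add: open_cube_def infnorm_mul)
  qed
  have "emeasure lebesgue (\<Union>i\<in>I. open_cube (c i) (r i)) \<le> emeasure lebesgue (\<Union>j\<in>I. V j \<inter> open_cube (c j) (r j))"
  proof (intro emeasure_mono subsetI)
    fix x assume "x \<in> (\<Union>i\<in>I. open_cube (c i) (r i))"
    then obtain i where i: "i \<in> I" "h i x < 0" by (auto simp: open_cube_def h_def)
    \<comment> \<open>The minimising index inherits the negative sign, so the point lies in the cube
      belonging to its own Voronoi cell.\<close>
    obtain j where "j \<in> I" "x \<in> V j" "h j x < 0" using Vex[OF i(1), of x] i(2) by (meson le_less_trans)
    then show "x \<in> (\<Union>j\<in>I. V j \<inter> open_cube (c j) (r j))" by (auto simp: open_cube_def h_def)
  qed (use I in auto)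
  also have "\<dots> \<le> (\<Sum>j\<in>I. emeasure lebesgue (V j \<inter> open_cube (c j) (r j)))"
    using I by (intro emeasure_subadditive_finite) auto
  finally have "ennreal (t ^ DIM('a)) * emeasure lebesgue (\<Union>i\<in>I. open_cube (c i) (r i)) \<le>
      (\<Sum>j\<in>I. ennreal (t ^ DIM('a)) * emeasure lebesgue (V j \<inter> open_cube (c j) (r j)))"
    unfolding sum_distrib_left[symmetric] by (rule mult_left_mono) simp
  also have "\<dots> = (\<Sum>j\<in>I. emeasure lebesgue (T j ` (V j \<inter> open_cube (c j) (r j))))"
    unfolding T_def using t by (subst emeasure_lebesgue_affine) (auto simp: abs_of_pos)
  also have "\<dots> \<le> (\<Sum>j\<in>I. emeasure lebesgue (V j \<inter> open_cube (c j) (t * r j)))"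
    using TV Tcb by (intro sum_mono emeasure_mono) auto
  also have "\<dots> = emeasure lebesgue (\<Union>j\<in>I. V j \<inter> open_cube (c j) (t * r j))"
    using I disj by (intro sum_emeasure) (auto simp: disjoint_family_on_def)
  also have "\<dots> \<le> emeasure lebesgue (\<Union>i\<in>I. open_cube (c i) (t * r i))"
    using I by (intro emeasure_mono) auto
  finally show ?thesis .
qed

section \<open>Doubling and the boundary layers of a family of cubes\<close>

text \<open>Subadditivity for the \<open>X i\<close> and additivity for the disjoint
  \<open>Y i\<close>. This sums up the local estimates after a Vitali selection and over stopping
  cells; two measures are allowed because \<open>W\<close> is also compared with Lebesgue
  measure.\<close>

lemma emeasure_UN_le_disjoint:
  assumes C: "countable C"
    and X: "\<And>i. i \<in> C \<Longrightarrow> X i \<in> sets M" and Y: "\<And>i. i \<in> C \<Longrightarrow> Y i \<in> sets N"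
    and disj: "disjoint_family_on Y C" and Z: "(\<Union>i\<in>C. Y i) \<subseteq> Z" "Z \<in> sets N"
    and le: "\<And>i. i \<in> C \<Longrightarrow> emeasure M (X i) \<le> K * emeasure N (Y i)"
  shows "emeasure M (\<Union>i\<in>C. X i) \<le> K * emeasure N Z"
proof -
  define f where "f = to_nat_on C"
  have f: "inj_on f C" using C unfolding f_def by (rule inj_on_to_nat_on)
  define pick where "pick n = (THE i. i \<in> C \<and> f i = n)" for n
  have pick [simp]: "pick (f i) = i" if "i \<in> C" for i
    unfolding pick_def using that f by (auto simp: inj_on_def)
  \<comment> \<open>Numbers that enumerate nothing get the empty set, so finite and infinite
    \<open>C\<close> are treated alike.\<close>
  define X' where "X' n = (if n \<in> f ` C then X (pick n) else {})" for n
  define Y' where "Y' n = (if n \<in> f ` C then Y (pick n) else {})" for n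
  have "(\<Union>i\<in>C. X i) = (\<Union>n. X' n)" by (auto simp: X'_def pick)
  also have "emeasure M \<dots> \<le> (\<Sum>n. emeasure M (X' n))"
    using X by (intro emeasure_subadditive_countably) (auto simp: X'_def pick)
  also have "\<dots> \<le> (\<Sum>n. K * emeasure N (Y' n))"
    using le by (intro suminf_le) (auto simp: X'_def Y'_def pick)
  also have "\<dots> = K * (\<Sum>n. emeasure N (Y' n))"
    by simp
  also have "(\<Sum>n. emeasure N (Y' n)) = emeasure N (\<Union>n. Y' n)"
  proof (rule suminf_emeasure)
    show "range Y' \<subseteq> sets N" using Y by (auto simp: Y'_def pick)
    show "disjoint_family Y'"
      using disj unfolding disjoint_family_on_def Y'_def by (smt (verit) Int_empty_left Int_empty_right imageE pick)
  qed
  also have "\<dots> \<le> emeasure N Z"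
    using Z by (intro emeasure_mono) (auto simp: Y'_def pick split: if_splits)
  finally show ?thesis by (simp add: mult_left_mono)
qed

text \<open>
  The last assumption is the \<open>A\<^sub>\<infinity>\<close> bound \<open>W F / W R \<le> C' (|F| / |R|)\<^sup>c\<close> in dyadic form:
  choosing \<open>j\<close> with \<open>4\<^sup>j\<close> of order \<open>1/t\<close> recovers the power.
\<close>

locale power_bounded_measure =
  fixes W :: "'a::euclidean_space measure" and C \<theta> :: real
  assumes sets_W [measurable_cong]: "sets W = sets lebesgue"
    and C_pos: "C > 0" and \<theta>: "1/2 \<le> \<theta>" "\<theta> < 1"
    and finite_open_cube: "emeasure W (open_cube c r) < \<infinity>"
    and emeasure_small: "\<lbrakk>F \<in> sets lebesgue; F \<subseteq> open_cube c r; r > 0; 0 \<le> t;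
         emeasure lebesgue F \<le> ennreal t * emeasure lebesgue (open_cube c r)\<rbrakk>
      \<Longrightarrow> emeasure W F \<le> ennreal (2^j * t + C * \<theta>^j) * emeasure W (open_cube c r)"
begin

text \<open>A cube of radius at least \<open>\<rho> * r\<close> inside one of radius
  \<open>r\<close> leaves out a small Lebesgue proportion, hence at most half of the
  \<open>W\<close>-mass, and finiteness allows this half to be absorbed. The cubes need not be
  concentric.\<close>

lemma doubling_step:
  "\<exists>\<rho>. 0 < \<rho> \<and> \<rho> < 1 \<and> (\<forall>(c::'a) c' r r'. infnorm (c' - c) \<le> r - r' \<longrightarrow> \<rho> * r \<le> r' \<longrightarrow> 0 < r \<longrightarrow>
      emeasure W (open_cube c r) \<le> 2 * emeasure W (open_cube c' r'))"
proof -
  let ?n = "DIM('a)"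
  have "(\<lambda>j. C * \<theta> ^ j) \<longlonglongrightarrow> C * 0"
    using \<theta> by (intro tendsto_intros LIMSEQ_realpow_zero) auto
  then have "\<forall>\<^sub>F j in sequentially. C * \<theta> ^ j < 1/4"
    by (intro order_tendstoD) auto
  then obtain j where j: "C * \<theta> ^ j < 1/4"
    by (meson eventually_happens trivial_limit_sequentially)
  \<comment> \<open>This makes \<open>2^j * t\<close> equal to 1/4, so that together with
    \<open>C * \<theta>^j\<close> it stays below 1/2.\<close>
  define t :: real where "t = 1 / (4 * 2^j)"
  have t: "0 < t" "t \<le> 1/4" by (simp_all add: t_def field_simps)
  \<comment> \<open>By Bernoulli's inequality the volume ratio \<open>\<rho> ^ ?n\<close> is at
    least \<open>1 - t\<close>.\<close>
  define \<rho> where "\<rho> = 1 - t / ?n"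
  have "t / ?n \<le> t" using t by (simp add: field_simps Suc_leI)
  with t have "t / ?n < 1" by linarith
  moreover have "0 < t / ?n" using t by simp
  ultimately have \<rho>: "0 < \<rho>" "\<rho> < 1" unfolding \<rho>_def by auto
  have "1 + real ?n * (- (t / ?n)) \<le> (1 + - (t / ?n)) ^ ?n"
    using \<open>t / ?n < 1\<close> by (intro Bernoulli_inequality) linarith
  then have \<rho>n: "1 - t \<le> \<rho> ^ ?n" by (simp add: \<rho>_def)
  have "emeasure W (open_cube c r) \<le> 2 * emeasure W (open_cube c' r')"
    if sub: "infnorm (c' - c) \<le> r - r'" and r': "\<rho> * r \<le> r'" and r: "0 < r" for r r' and c c' :: 'a
  proof -
    have "r' > 0" using r r' \<rho> by (smt (verit) mult_pos_pos)
    have S: "open_cube c' r' \<subseteq> open_cube c r" using sub by (rule open_cube_subset)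
    let ?F = "open_cube c r - open_cube c' r'"
    have "emeasure lebesgue ?F = ennreal ((2*r)^?n) - ennreal ((2*r')^?n)"
      using S r \<open>r' > 0\<close> by (subst emeasure_Diff) (auto simp: emeasure_open_cube simp del: emeasure_completion)
    also have "\<dots> = ennreal ((2*r)^?n - (2*r')^?n)"
      using \<open>r' > 0\<close> by (subst ennreal_minus) auto
    also have "\<dots> \<le> ennreal (t * (2*r)^?n)"
    proof (rule ennreal_leI)
      have "(1 - t) * (2*r)^?n \<le> \<rho>^?n * (2*r)^?n"
        using \<rho>n r by (intro mult_right_mono) auto
      also have "\<dots> = (2 * (\<rho> * r))^?n" by (simp add: power_mult_distrib)
      also have "\<dots> \<le> (2*r')^?n" using r' \<rho> r by (intro power_mono) auto
      finally show "(2*r)^?n - (2*r')^?n \<le> t * (2*r)^?n" by (simp add: algebra_simps)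
    qed
    also have "\<dots> = ennreal t * emeasure lebesgue (open_cube c r)"
      using r t by (simp add: emeasure_open_cube ennreal_mult)
    finally have "emeasure W ?F \<le> ennreal (2^j * t + C * \<theta>^j) * emeasure W (open_cube c r)"
      using r t by (intro emeasure_small) auto
    also have "\<dots> \<le> ennreal (1/2) * emeasure W (open_cube c r)"
      using j by (intro mult_right_mono ennreal_leI) (auto simp: t_def)
    finally have F: "emeasure W ?F \<le> ennreal (1/2) * emeasure W (open_cube c r)" .
    have "emeasure W (open_cube c r) = emeasure W (open_cube c' r') + emeasure W ?F"
      using S by (subst plus_emeasure) (auto simp: sets_W intro!: arg_cong2[where f=emeasure])
    with F have "emeasure W (open_cube c r) \<le> emeasure W (open_cube c' r') + ennreal (1/2) * emeasure W (open_cube c r)"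
      by (simp add: add_left_mono)
    moreover obtain a where a: "a \<ge> 0" "emeasure W (open_cube c r) = ennreal a"
      using finite_open_cube[of c r] by (cases "emeasure W (open_cube c r)") auto
    moreover obtain b where b: "b \<ge> 0" "emeasure W (open_cube c' r') = ennreal b"
      using finite_open_cube[of c' r'] by (cases "emeasure W (open_cube c' r')") auto
    moreover have "ennreal (b + 1/2 * a) = ennreal b + ennreal (1/2) * ennreal a"
      using a b by (subst ennreal_plus, simp, simp, subst ennreal_mult) auto
    ultimately have "ennreal a \<le> ennreal (b + 1/2 * a)" by metis
    then have "a \<le> b + 1/2 * a" using a b by (subst (asm) ennreal_le_iff) auto
    then have "ennreal a \<le> ennreal (2 * b)" by (intro ennreal_leI) simp
    then show ?thesis using a b by (simp add: ennreal_mult)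
  qed
  with \<rho> show ?thesis by blast
qed

text \<open>Iterates the one-step bound along cubes interpolated between the outer and the inner
  one. If \<open>m\<close> steps reach the ratio 1/4, then \<open>D = 2^m\<close> works. Powers of 4
  match the shrinking factors \<open>1 - 1/4^k\<close> used below.\<close>

lemma doubling:
  "\<exists>D\<ge>1. \<forall>k (c::'a) c' r r'. infnorm (c' - c) \<le> r - r' \<longrightarrow> r \<le> 4^k * r' \<longrightarrow> 0 < r \<longrightarrow>
      emeasure W (open_cube c r) \<le> ennreal (D^k) * emeasure W (open_cube c' r')"
proof -
  obtain \<rho> where \<rho>: "0 < \<rho>" "\<rho> < 1" and step: "\<And>(c::'a) c' r r'. \<lbrakk>infnorm (c' - c) \<le> r - r'; \<rho> * r \<le> r'; 0 < r\<rbrakk>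
      \<Longrightarrow> emeasure W (open_cube c r) \<le> 2 * emeasure W (open_cube c' r')"
    using doubling_step by blast
  have chain: "emeasure W (open_cube c r) \<le> ennreal (2^i) * emeasure W (open_cube c' r')"
    if "infnorm (c' - c) \<le> r - r'" "\<rho>^i * r \<le> r'" "0 < r" for i r r' and c c' :: 'a
    using that
  proof (induction i arbitrary: c' r')
    case 0
    then have "r = r'" "infnorm (c' - c) = 0" using infnorm_pos_le[of "c' - c"] by auto
    then show ?case by (simp add: infnorm_eq_0)
  next
    case (Suc i)
    \<comment> \<open>The inner cube is enlarged by one factor \<open>1 / \<rho>\<close>, but not
      beyond the outer cube.\<close>
    define r'' where "r'' = min r (r' / \<rho>)"
    have "r' > 0" using Suc.prems \<rho> by (smt (verit) mult_pos_pos zero_less_power)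
    have "r' \<le> r" using Suc.prems infnorm_pos_le[of "c' - c"] by linarith
    have "r' * \<rho> \<le> r' * 1" using \<open>r' > 0\<close> \<rho> by (intro mult_left_mono) auto
    then have "r' \<le> r' / \<rho>" using \<rho> by (simp add: field_simps)
    then have r'': "r' \<le> r''" "r'' \<le> r" "\<rho> * r'' \<le> r'"
      using \<rho> \<open>r' \<le> r\<close> by (auto simp: r''_def min_def field_simps)
    have "\<rho>^i * r \<le> r' / \<rho>" using Suc.prems \<rho> by (simp add: field_simps)
    moreover have "\<rho>^i * r \<le> 1 * r" using Suc.prems \<rho> by (intro mult_right_mono) (auto simp: power_le_one)
    ultimately have i: "\<rho>^i * r \<le> r''" by (simp add: r''_def)
    \<comment> \<open>Position of the intermediate cube between the inner and the outer one, used
      for centre and radius alike. If \<open>r = r'\<close>, division by zero yields 0, which is the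
      right value.\<close>
    define \<tau> where "\<tau> = (r'' - r') / (r - r')"
    define c'' where "c'' = c' + \<tau> *\<^sub>R (c - c')"
    have \<tau>: "0 \<le> \<tau>" "\<tau> \<le> 1" "\<tau> * (r - r') = r'' - r'"
      using r'' \<open>r' \<le> r\<close> by (auto simp: \<tau>_def divide_le_eq_1)
    have "infnorm (c'' - c) = (1 - \<tau>) * infnorm (c' - c)"
    proof -
      have "c'' - c = (1 - \<tau>) *\<^sub>R (c' - c)" by (simp add: c''_def algebra_simps)
      then show ?thesis using \<tau> by (simp add: infnorm_mul)
    qed
    also have "\<dots> \<le> (1 - \<tau>) * (r - r')" using Suc.prems \<tau> by (intro mult_left_mono) auto
    also have "\<dots> = r - r''" using \<tau>(3) by (simp add: algebra_simps)
    finally have "emeasure W (open_cube c r) \<le> ennreal (2^i) * emeasure W (open_cube c'' r'')"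
      using i Suc.prems by (intro Suc.IH)
    also have "emeasure W (open_cube c'' r'') \<le> 2 * emeasure W (open_cube c' r')"
    proof (rule step)
      have "c' - c'' = \<tau> *\<^sub>R (c' - c)" by (simp add: c''_def algebra_simps)
      then have "infnorm (c' - c'') = \<tau> * infnorm (c' - c)" using \<tau> by (simp add: infnorm_mul)
      also have "\<dots> \<le> \<tau> * (r - r')" using Suc.prems \<tau> by (intro mult_left_mono) auto
      finally show "infnorm (c' - c'') \<le> r'' - r'" using \<tau>(3) by simp
    qed (use r'' \<open>r' > 0\<close> in auto)
    finally show ?case by (simp add: ennreal_mult mult_left_mono mult.assoc mult.left_commute)
  qed
  obtain m where m: "\<rho>^m < 1/4" using real_arch_pow_inv[of "1/4" \<rho>] \<rho> by auto
  show ?thesis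
  proof (intro exI[of _ "2^m"] conjI allI impI)
    fix k r r' and c c' :: 'a
    assume *: "infnorm (c' - c) \<le> r - r'" "r \<le> 4^k * r'" "0 < (r::real)"
    have "\<rho>^(m*k) * r \<le> (1/4)^k * r"
      unfolding power_mult using m \<rho> * by (intro mult_right_mono power_mono) auto
    also have "\<dots> \<le> (1/4)^k * (4^k * r')" using * by (intro mult_left_mono) auto
    also have "\<dots> = r'" by (simp add: power_one_over)
    finally show "emeasure W (open_cube c r) \<le> ennreal ((2^m)^k) * emeasure W (open_cube c' r')"
      using chain[of c' c r r' "m*k"] * by (simp add: power_mult)
  qed simp
qed

text \<open>
  A point of a shrunken cube carries a ball of radius comparable to \<open>4\<^sup>-\<^sup>k\<close> times the side that stays
  inside the original cube; doubling turns the hypothesis on the cube into one on the ball.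
\<close>

lemma inner_part_bound:
  fixes c :: "'i \<Rightarrow> 'a"
  assumes D: "\<And>k (c::'a) c' r r'. \<lbrakk>infnorm (c' - c) \<le> r - r'; r \<le> 4^k * r'; 0 < r\<rbrakk> \<Longrightarrow>
      emeasure W (open_cube c r) \<le> ennreal (D^k) * emeasure W (open_cube c' r')" and D0: "D \<ge> 1"
    and I: "finite I" "\<And>i. i \<in> I \<Longrightarrow> 0 < r i" and E: "E \<in> sets lebesgue" and \<beta>: "\<beta> \<ge> 0"
    and EQ: "\<And>i. i \<in> I \<Longrightarrow> emeasure W (open_cube (c i) (r i) - E) \<le> ennreal \<beta> * emeasure W (open_cube (c i) (r i))"
    and m: "6 * sqrt DIM('a) \<le> 4^m"
  shows "emeasure W ((\<Union>i\<in>I. open_cube (c i) ((1 - 1/4^k) * r i)) - E)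
      \<le> ennreal (\<beta> * D^(k+m)) * emeasure W (\<Union>i\<in>I. open_cube (c i) (r i))"
proof -
  define s :: real where "s = 1/4^k"
  have s: "0 < s" "s \<le> 1" by (auto simp: s_def)
  define d where "d = sqrt DIM('a)"
  have d: "d \<ge> 1" by (simp add: d_def Suc_leI)
  \<comment> \<open>All points of all shrunken cubes are used, each together with its cube; Vitali's
    lemma extracts a countable subfamily.\<close>
  define K where "K = Sigma I (\<lambda>i. open_cube (c i) ((1 - s) * r i))"
  \<comment> \<open>The factor 1/6 leaves room for the fivefold ball of Vitali's lemma: it must stay
    within distance \<open>s * r (fst p)\<close> of the point, hence inside the original
    cube.\<close>
  define \<rho> where "\<rho> p = s * r (fst p) / 6" for p :: "'i \<times> 'a"
  have \<rho>: "0 < \<rho> p \<and> \<rho> p \<le> (\<Sum>i\<in>I. r i)" if "p \<in> K" for p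
  proof -
    have i: "fst p \<in> I" using that by (auto simp: K_def)
    have "r (fst p) \<le> (\<Sum>i\<in>I. r i)" using I(2) i by (intro member_le_sum) (auto simp: I less_imp_le)
    moreover have "s * r (fst p) \<le> 1 * r (fst p)" using s I(2)[OF i] by (intro mult_right_mono) auto
    ultimately have "s * r (fst p) / 6 \<le> (\<Sum>i\<in>I. r i)" using I(2)[OF i] by linarith
    then show ?thesis using s I(2)[OF i] by (simp add: \<rho>_def)
  qed
  have cov: "(\<Union>i\<in>I. open_cube (c i) ((1 - s) * r i)) - E \<subseteq> (\<Union>p\<in>K. cball (snd p) (\<rho> p))"
  proof
    fix x assume "x \<in> (\<Union>i\<in>I. open_cube (c i) ((1 - s) * r i)) - E"
    then obtain i where "(i, x) \<in> K" by (auto simp: K_def)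
    with \<rho>[OF this] show "x \<in> (\<Union>p\<in>K. cball (snd p) (\<rho> p))" by force
  qed
  obtain P where P: "countable P" "P \<subseteq> K"
     "pairwise (\<lambda>i j. disjnt (cball (snd i) (\<rho> i)) (cball (snd j) (\<rho> j))) P"
     "(\<Union>i\<in>I. open_cube (c i) ((1 - s) * r i)) - E \<subseteq> (\<Union>i\<in>P. cball (snd i) (5 * \<rho> i))"
    by (rule Vitali_covering_lemma_cballs[OF cov \<rho>]) (blast intro: that)+
  \<comment> \<open>Doubling compares cubes, so the disjoint family consists of cubes inscribed in
    the disjoint balls.\<close>
  have sub: "open_cube (snd p) (\<rho> p / d) \<subseteq> cball (snd p) (\<rho> p)" if "p \<in> P" for p
  proof -
    have "open_cube (snd p) (\<rho> p / d) \<subseteq> ball (snd p) (d * (\<rho> p / d))" unfolding d_def by (rule open_cube_subset_ball)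
    also have "d * (\<rho> p / d) = \<rho> p" using d by simp
    finally show ?thesis using ball_subset_cball by blast
  qed
  have inn: "infnorm (snd p - c (fst p)) \<le> r (fst p) - s * r (fst p)" if "p \<in> P" for p
    using that P by (auto simp: K_def open_cube_def algebra_simps dest!: subsetD)
  have small: "\<rho> p / d \<le> s * r (fst p)" if "p \<in> P" for p
  proof -
    have "\<rho> p / d \<le> \<rho> p / 1" using d \<rho>[of p] that P by (intro divide_left_mono) auto
    also have "\<dots> \<le> s * r (fst p)" using \<rho>[of p] that P by (auto simp: \<rho>_def dest: subsetD)
    finally show ?thesis .
  qed
  have "emeasure W ((\<Union>i\<in>I. open_cube (c i) ((1 - s) * r i)) - E)
      \<le> emeasure W (\<Union>p\<in>P. cball (snd p) (5 * \<rho> p) - E)"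
  proof (rule emeasure_mono)
    show "(\<Union>i\<in>I. open_cube (c i) ((1 - s) * r i)) - E \<subseteq> (\<Union>p\<in>P. cball (snd p) (5 * \<rho> p) - E)"
      using P(4) by blast
    show "(\<Union>p\<in>P. cball (snd p) (5 * \<rho> p) - E) \<in> sets W"
      using E P(1) by (auto simp: sets_W intro!: sets.countable_UN')
  qed
  also have "\<dots> \<le> ennreal (\<beta> * D^(k+m)) * emeasure W (\<Union>i\<in>I. open_cube (c i) (r i))"
  proof (rule emeasure_UN_le_disjoint[OF P(1), where Y = "\<lambda>p. open_cube (snd p) (\<rho> p / d)"])
    show "disjoint_family_on (\<lambda>p. open_cube (snd p) (\<rho> p / d)) P"
      using P(3) sub unfolding disjoint_family_on_def pairwise_def disjnt_def by blast
    show "(\<Union>p\<in>P. open_cube (snd p) (\<rho> p / d)) \<subseteq> (\<Union>i\<in>I. open_cube (c i) (r i))"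
    proof (rule UN_least)
      fix p assume p: "p \<in> P"
      then have "open_cube (snd p) (\<rho> p / d) \<subseteq> open_cube (c (fst p)) (r (fst p))"
        using inn[OF p] small[OF p] by (intro open_cube_subset) simp
      moreover have "fst p \<in> I" using p P(2) by (auto simp: K_def)
      ultimately show "open_cube (snd p) (\<rho> p / d) \<subseteq> (\<Union>i\<in>I. open_cube (c i) (r i))" by blast
    qed
    show "(\<Union>i\<in>I. open_cube (c i) (r i)) \<in> sets W" using I by (auto simp: sets_W)
    fix p assume p: "p \<in> P"
    then have i: "fst p \<in> I" and r: "r (fst p) > 0" using P I by (auto simp: K_def)
    show "cball (snd p) (5 * \<rho> p) - E \<in> sets W" "open_cube (snd p) (\<rho> p / d) \<in> sets W"
      using E by (auto simp: sets_W)
    have "cball (snd p) (5 * \<rho> p) \<subseteq> open_cube (snd p) (s * r (fst p))"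
      using \<rho>[of p] p P(2) ball_subset_open_cube[of "snd p" "s * r (fst p)"] by (fastforce simp: \<rho>_def)
    also have "\<dots> \<subseteq> open_cube (c (fst p)) (r (fst p))"
      using inn[OF p] by (intro open_cube_subset) simp
    finally have "emeasure W (cball (snd p) (5 * \<rho> p) - E) \<le> emeasure W (open_cube (c (fst p)) (r (fst p)) - E)"
      using E by (intro emeasure_mono) (auto simp: sets_W)
    also have "\<dots> \<le> ennreal \<beta> * emeasure W (open_cube (c (fst p)) (r (fst p)))" using EQ[OF i] .
    also have "emeasure W (open_cube (c (fst p)) (r (fst p))) \<le> ennreal (D^(k+m)) * emeasure W (open_cube (snd p) (\<rho> p / d))"
    proof (rule D)
      show "infnorm (snd p - c (fst p)) \<le> r (fst p) - \<rho> p / d" using inn[OF p] small[OF p] by simp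
      \<comment> \<open>The ratio of the radii splits into \<open>4^k\<close> from the shrinking and
        the dimensional factor \<open>6 * d\<close>, which \<open>4^m\<close> absorbs.\<close>
      have "4^k * (6 * d) * (\<rho> p / d) = r (fst p)" using d by (simp add: \<rho>_def s_def)
      moreover have "4^k * (6 * d) * (\<rho> p / d) \<le> 4^k * 4^m * (\<rho> p / d)"
        using m d \<rho>[of p] p P by (intro mult_right_mono mult_left_mono) (auto simp: d_def)
      ultimately show "r (fst p) \<le> 4^(k+m) * (\<rho> p / d)" by (simp add: power_add)
    qed (use r in auto)
    finally show "emeasure W (cball (snd p) (5 * \<rho> p) - E) \<le> ennreal (\<beta> * D^(k+m)) * emeasure W (open_cube (snd p) (\<rho> p / d))"
      using \<beta> D0 by (simp add: ennreal_mult mult_left_mono mult.assoc)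
  qed
  finally show ?thesis by (simp add: s_def)
qed

text \<open>
  Vitali's lemma groups the cubes around disjoint ones that dominate them in size. Inside one group the
  boundary layer has small Lebesgue measure, by the shrinking lemma, hence small \<open>W\<close>-measure.
\<close>

lemma boundary_part_bound:
  fixes c :: "'i \<Rightarrow> 'a"
  assumes D: "\<And>k (c::'a) c' r r'. \<lbrakk>infnorm (c' - c) \<le> r - r'; r \<le> 4^k * r'; 0 < r\<rbrakk> \<Longrightarrow>
      emeasure W (open_cube c r) \<le> ennreal (D^k) * emeasure W (open_cube c' r')" and D0: "D \<ge> 1"
    and I: "finite I" "\<And>i. i \<in> I \<Longrightarrow> 0 < r i" and m: "6 * sqrt DIM('a) \<le> 4^m"
  shows "emeasure W ((\<Union>i\<in>I. open_cube (c i) (r i)) - (\<Union>i\<in>I. open_cube (c i) ((1 - 1/4^k) * r i)))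
      \<le> ennreal ((DIM('a) + C) * D^m * \<theta>^k) * emeasure W (\<Union>i\<in>I. open_cube (c i) (r i))"
proof -
  define s :: real where "s = 1/4^k"
  have s: "0 < s" "s \<le> 1" by (auto simp: s_def)
  define d where "d = sqrt DIM('a)"
  have d: "d \<ge> 1" by (simp add: d_def Suc_leI)
  have r: "0 < d * r i \<and> d * r i \<le> (\<Sum>i\<in>I. d * r i)" if "i \<in> I" for i
  proof
    show "0 < d * r i" using d I(2)[OF that] by simp
    have "0 \<le> d * r j" if "j \<in> I" for j using d I(2)[OF that] by simp
    then show "d * r i \<le> (\<Sum>i\<in>I. d * r i)" using that I(1) by (intro member_le_sum) auto
  qed
  \<comment> \<open>Vitali's lemma concerns Euclidean balls, so each cube is enclosed in one of
    radius \<open>d * r i\<close>.\<close>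
  obtain P where P: "countable P" "P \<subseteq> I"
     "pairwise (\<lambda>i j. disjnt (cball (c i) (d * r i)) (cball (c j) (d * r j))) P"
     "\<And>i. i \<in> I \<Longrightarrow> \<exists>j. j \<in> P \<and> \<not> disjnt (cball (c i) (d * r i)) (cball (c j) (d * r j)) \<and>
                        cball (c i) (d * r i) \<subseteq> ball (c j) (5 * (d * r j))"
    by (rule Vitali_covering_lemma_cballs_balls[OF r, where a=c]) (blast intro: that)+
  then have "\<forall>i\<in>I. \<exists>j. j \<in> P \<and> cball (c i) (d * r i) \<subseteq> ball (c j) (5 * (d * r j))"
    by blast
  then obtain g where g: "\<And>i. i \<in> I \<Longrightarrow> g i \<in> P"
     "\<And>i. i \<in> I \<Longrightarrow> cball (c i) (d * r i) \<subseteq> ball (c (g i)) (5 * (d * r (g i)))"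
    unfolding bchoice_iff by blast
  define G where "G j = {i\<in>I. g i = j}" for j
  define U where "U j = (\<Union>i\<in>G j. open_cube (c i) (r i))" for j
  define U' where "U' j = (\<Union>i\<in>G j. open_cube (c i) ((1 - s) * r i))" for j
  have finG: "finite (G j)" for j using I by (simp add: G_def)
  have meas: "U j \<in> sets lebesgue" "U' j \<in> sets lebesgue" for j
    unfolding U_def U'_def using finG by auto
  have U'U: "U' j \<subseteq> U j" for j
    unfolding U_def U'_def
  proof (rule UN_mono)
    fix i assume "i \<in> G j"
    then have "r i > 0" using I by (auto simp: G_def)
    then show "open_cube (c i) ((1 - s) * r i) \<subseteq> open_cube (c i) (r i)"
      using s by (intro open_cube_subset) (simp add: infnorm_0 algebra_simps)
  qed simp
  have UR: "U j \<subseteq> open_cube (c j) (5 * (d * r j))" for j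
  proof -
    have "open_cube (c i) (r i) \<subseteq> open_cube (c j) (5 * (d * r j))" if "i \<in> G j" for i
    proof -
      have "open_cube (c i) (r i) \<subseteq> ball (c i) (d * r i)" unfolding d_def by (rule open_cube_subset_ball)
      also have "\<dots> \<subseteq> cball (c i) (d * r i)" by (rule ball_subset_cball)
      also have "\<dots> \<subseteq> ball (c j) (5 * (d * r j))" using g(2) that by (auto simp: G_def)
      also have "\<dots> \<subseteq> open_cube (c j) (5 * (d * r j))" by (rule ball_subset_open_cube)
      finally show ?thesis .
    qed
    then show ?thesis by (auto simp: U_def)
  qed
  have "emeasure W ((\<Union>i\<in>I. open_cube (c i) (r i)) - (\<Union>i\<in>I. open_cube (c i) ((1 - s) * r i)))
      \<le> emeasure W (\<Union>j\<in>P. U j - U' j)"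
  proof (rule emeasure_mono)
    show "(\<Union>i\<in>I. open_cube (c i) (r i)) - (\<Union>i\<in>I. open_cube (c i) ((1 - s) * r i)) \<subseteq> (\<Union>j\<in>P. U j - U' j)"
      using g(1) by (fastforce simp: U_def U'_def G_def)
    show "(\<Union>j\<in>P. U j - U' j) \<in> sets W"
      using meas P(1) by (auto simp: sets_W intro!: sets.countable_UN')
  qed
  also have "\<dots> \<le> ennreal ((DIM('a) + C) * D^m * \<theta>^k) * emeasure W (\<Union>i\<in>I. open_cube (c i) (r i))"
  proof (rule emeasure_UN_le_disjoint[OF P(1), where Y = "\<lambda>i. open_cube (c i) (r i)"])
    have sub: "open_cube (c i) (r i) \<subseteq> cball (c i) (d * r i)" for i
      unfolding d_def using open_cube_subset_ball ball_subset_cball by blast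
    show "disjoint_family_on (\<lambda>i. open_cube (c i) (r i)) P"
      using P(3) sub unfolding disjoint_family_on_def pairwise_def disjnt_def by blast
    show "(\<Union>i\<in>P. open_cube (c i) (r i)) \<subseteq> (\<Union>i\<in>I. open_cube (c i) (r i))" using P(2) by blast
    show "(\<Union>i\<in>I. open_cube (c i) (r i)) \<in> sets W" using I by (auto simp: sets_W)
    fix j assume j: "j \<in> P"
    then have rj: "r j > 0" using P I by auto
    show "U j - U' j \<in> sets W" "open_cube (c j) (r j) \<in> sets W" using meas by (auto simp: sets_W)
    let ?R = "open_cube (c j) (5 * (d * r j))" let ?n = "DIM('a)"
    have R: "5 * (d * r j) > 0" using rj d by simp
    have finR: "emeasure lebesgue ?R < \<infinity>" using R by (simp add: emeasure_open_cube)
    obtain u where u: "u \<ge> 0" "emeasure lebesgue (U j) = ennreal u"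
      using emeasure_mono[OF UR[of j], of lebesgue] finR
      by (cases "emeasure lebesgue (U j)") (auto simp: top_unique)
    have finU': "emeasure lebesgue (U' j) \<noteq> \<infinity>"
      using emeasure_mono[OF U'U[of j], of lebesgue] meas u by (auto simp: top_unique)
    have "emeasure lebesgue (U j - U' j) \<le> ennreal (?n * s) * emeasure lebesgue (U j)"
    proof (cases "k = 0")
      \<comment> \<open>Here \<open>s = 1\<close>, so the shrinking lemma, which needs a positive
        factor, does not apply; but \<open>?n * s\<close> is at least 1 and the bound is
        trivial.\<close>
      case True
      then have "emeasure lebesgue (U j) \<le> ennreal (?n * s) * emeasure lebesgue (U j)"
        using u by (auto simp: s_def Suc_leI mult_le_cancel_right1 simp flip: ennreal_mult intro!: ennreal_leI)
      moreover have "emeasure lebesgue (U j - U' j) \<le> emeasure lebesgue (U j)"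
        using meas by (intro emeasure_mono) auto
      ultimately show ?thesis by (rule order_trans[rotated])
    next
      case False
      then have "s < 1" by (simp add: s_def)
      have "1 + real ?n * (- s) \<le> (1 + (- s))^?n" using s by (intro Bernoulli_inequality) auto
      then have B: "1 - ?n * s \<le> (1 - s)^?n" by simp
      have "emeasure lebesgue (U j - U' j) = emeasure lebesgue (U j) - emeasure lebesgue (U' j)"
        using finU' meas U'U by (intro emeasure_Diff) auto
      also have "\<dots> \<le> emeasure lebesgue (U j) - ennreal ((1 - s)^?n) * emeasure lebesgue (U j)"
        unfolding U_def U'_def using finG s \<open>s < 1\<close> by (intro ennreal_minus_mono shrink_cubes_lebesgue) auto
      also have "\<dots> = ennreal (u - (1 - s)^?n * u)"
        using u s by (simp add: ennreal_minus flip: ennreal_mult)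
      also have "\<dots> \<le> ennreal (?n * s * u)"
      proof (rule ennreal_leI)
        have "(1 - ?n * s) * u \<le> (1 - s)^?n * u" using B u by (intro mult_right_mono) auto
        then show "u - (1 - s)^?n * u \<le> ?n * s * u" by (simp add: algebra_simps)
      qed
      also have "\<dots> = ennreal (?n * s) * emeasure lebesgue (U j)"
        using u s by (simp add: ennreal_mult)
      finally show ?thesis .
    qed
    also have "\<dots> \<le> ennreal (?n * s) * emeasure lebesgue ?R"
      using UR by (intro mult_left_mono emeasure_mono) auto
    finally have "emeasure W (U j - U' j) \<le> ennreal (2^k * (?n * s) + C * \<theta>^k) * emeasure W ?R"
      using R s meas UR by (intro emeasure_small) auto
    also have "\<dots> \<le> ennreal ((?n + C) * \<theta>^k) * emeasure W ?R"
    proof (intro mult_right_mono ennreal_leI)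
      \<comment> \<open>The reason for shrinking by the proportion \<open>1/4^k\<close>: after the
        factor \<open>2^k\<close> of \<open>emeasure_small\<close> there remains
        \<open>(1/2)^k\<close>, which is at most \<open>\<theta>^k\<close> because
        \<open>\<theta> \<ge> 1/2\<close>.\<close>
      have "2^k * s = (1/2)^k"
        by (simp add: s_def power_one_over field_simps flip: power_mult_distrib)
      also have "\<dots> \<le> \<theta>^k" using \<theta> by (intro power_mono) auto
      finally have "?n * (2^k * s) \<le> ?n * \<theta>^k" by (intro mult_left_mono) auto
      then show "2^k * (?n * s) + C * \<theta>^k \<le> (?n + C) * \<theta>^k" by (simp add: algebra_simps)
    qed simp
    also have "emeasure W ?R \<le> ennreal (D^m) * emeasure W (open_cube (c j) (r j))"
    proof (rule D)
      have "1 * r j \<le> 5 * d * r j" using d rj by (intro mult_right_mono) auto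
      then show "infnorm (c j - c j) \<le> 5 * (d * r j) - r j" by (simp add: infnorm_0)
      have "5 * d \<le> 4^m" using m d unfolding d_def by linarith
      then show "5 * (d * r j) \<le> 4^m * r j" using rj by (simp flip: mult.assoc)
    qed (use R in auto)
    finally show "emeasure W (U j - U' j) \<le> ennreal ((?n + C) * D^m * \<theta>^k) * emeasure W (open_cube (c j) (r j))"
      using D0 C_pos \<theta> by (simp add: ennreal_mult mult_left_mono mult_right_mono ac_simps)
  qed
  finally show ?thesis by (simp add: s_def)
qed

end

text \<open>Lindelof's theorem reduces to a countable subfamily, whose finite partial unions
  increase to the whole; then continuity from below applies.\<close>

lemma emeasure_UN_open_le:
  fixes f :: "'i \<Rightarrow> 'a::second_countable_topology set"
  assumes M: "sets borel \<subseteq> sets M" and f: "\<And>i. i \<in> K \<Longrightarrow> open (f i)"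
    and le: "\<And>J. finite J \<Longrightarrow> J \<subseteq> K \<Longrightarrow> emeasure M (\<Union>i\<in>J. f i) \<le> b"
  shows "emeasure M (\<Union>i\<in>K. f i) \<le> b"
proof -
  obtain F where F: "F \<subseteq> f ` K" "countable F" "\<Union>F = \<Union>(f ` K)"
    using Lindelof[of "f ` K"] f by blast
  obtain K' where K': "countable K'" "K' \<subseteq> K" "F = f ` K'"
    using F(1,2) by (meson countable_subset_image)
  show ?thesis
  proof (cases "K' = {}")
    case True
    then show ?thesis using F(3) K'(3) by simp
  next
    case False
    define p where "p = from_nat_into K'"
    have range_p: "range p = K'"
      unfolding p_def using K'(1) False by (simp add: range_from_nat_into)
    define V where "V n = (\<Union>i\<in>p ` {..n}. f i)" for n
    have pK: "p ` {..n} \<subseteq> K" for n using range_p K'(2) by blast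
    have "open (V n)" for n
      unfolding V_def using pK by (intro open_UN ballI f) (auto dest: subsetD)
    then have "V n \<in> sets M" for n by (intro subsetD[OF M] borel_open)
    then have V: "range V \<subseteq> sets M" by (rule image_subsetI)
    have "V m \<subseteq> V n" if "m \<le> n" for m n
      unfolding V_def using that by (intro UN_mono image_mono) auto
    then have incV: "incseq V" by (simp add: incseq_def)
    have "(\<Union>i\<in>K. f i) = (\<Union>i\<in>range p. f i)" using F(3) K'(3) range_p by simp
    also have "\<dots> = (\<Union>n. V n)" unfolding V_def by auto
    also have "emeasure M \<dots> = (SUP n. emeasure M (V n))"
      using V incV by (rule SUP_emeasure_incseq[symmetric])
    also have "\<dots> \<le> b"
      unfolding V_def using pK by (intro SUP_least le) auto
    finally show ?thesis .
  qed
qed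

section \<open>Halo bounds for finite and for arbitrary families of cubes\<close>

context power_bounded_measure
begin

text \<open>With \<open>U\<close> the union and \<open>U'\<close> the union of the shrunken cubes,
  \<open>U\<close> lies in \<open>E\<close>, \<open>U' - E\<close> and \<open>U - U'\<close>
  together. The last two sets have at most \<open>\<eta>\<close> times the mass of \<open>U\<close>,
  which can be absorbed: the mass of \<open>U\<close> is finite since the family is, and
  \<open>1 / (1 - \<eta>) \<le> 1 + 2 * \<eta>\<close> for
  \<open>0 \<le> \<eta> \<le> 1/2\<close>.\<close>

lemma finite_halo_bound:
  obtains A D B where "A \<ge> 0" "D \<ge> 1" "B \<ge> 0"
    "\<And>E \<beta> K k. \<lbrakk>E \<in> sets lebesgue; \<beta> \<ge> 0; finite K;
      \<forall>p\<in>K. 0 < snd p \<and> emeasure W (open_cube (fst p) (snd p) - E) \<le> ennreal \<beta> * emeasure W (open_cube (fst p) (snd p));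
      \<beta> * A * D^k + B * \<theta>^k \<le> 1/2\<rbrakk> \<Longrightarrow>
      emeasure W (\<Union>p\<in>K. open_cube (fst p) (snd p)) \<le> ennreal (1 + 2 * (\<beta> * A * D^k + B * \<theta>^k)) * emeasure W E"
proof -
  obtain D where D: "D \<ge> 1" "\<And>k (c::'a) c' r r'. \<lbrakk>infnorm (c' - c) \<le> r - r'; r \<le> 4^k * r'; 0 < r\<rbrakk> \<Longrightarrow>
      emeasure W (open_cube c r) \<le> ennreal (D^k) * emeasure W (open_cube c' r')"
    using doubling by metis
  obtain m where m: "6 * sqrt DIM('a) < 4^m" using real_arch_pow[of 4] by auto
  have "emeasure W (\<Union>p\<in>K. open_cube (fst p) (snd p)) \<le> ennreal (1 + 2 * (\<beta> * D^m * D^k + ((DIM('a) + C) * D^m) * \<theta>^k)) * emeasure W E"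
    if E: "E \<in> sets lebesgue" and \<beta>: "\<beta> \<ge> 0" and K: "finite K"
      "\<forall>p\<in>K. 0 < snd p \<and> emeasure W (open_cube (fst p) (snd p) - E) \<le> ennreal \<beta> * emeasure W (open_cube (fst p) (snd p))"
      and half: "\<beta> * D^m * D^k + ((DIM('a) + C) * D^m) * \<theta>^k \<le> 1/2" for E \<beta> K k
  proof -
    define \<eta> where "\<eta> = \<beta> * D^m * D^k + ((DIM('a) + C) * D^m) * \<theta>^k"
    have \<eta>: "0 \<le> \<eta>" "\<eta> \<le> 1/2" using half \<beta> D C_pos \<theta> by (auto simp: \<eta>_def)
    define U where "U = (\<Union>p\<in>K. open_cube (fst p) (snd p))"
    define U' where "U' = (\<Union>p\<in>K. open_cube (fst p) ((1 - 1/4^k) * snd p))"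
    have meas: "U \<in> sets W" "U' \<in> sets W" "E \<in> sets W" using K(1) E by (auto simp: U_def U'_def sets_W)
    have r: "0 < snd p" if "p \<in> K" for p using K(2) that by simp
    have EQ: "emeasure W (open_cube (fst p) (snd p) - E) \<le> ennreal \<beta> * emeasure W (open_cube (fst p) (snd p))"
      if "p \<in> K" for p using K(2) that by simp
    have "emeasure W (U' - E) \<le> ennreal (\<beta> * D^(k+m)) * emeasure W U"
      unfolding U_def U'_def
      by (rule inner_part_bound[where c=fst and r=snd and D=D, OF D(2) D(1) K(1) r E \<beta> EQ less_imp_le[OF m]])
    moreover have "emeasure W (U - U') \<le> ennreal ((DIM('a) + C) * D^m * \<theta>^k) * emeasure W U"
      unfolding U_def U'_def
      by (rule boundary_part_bound[where c=fst and r=snd and D=D, OF D(2) D(1) K(1) r less_imp_le[OF m]])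
    moreover have "emeasure W U \<le> emeasure W (E \<union> ((U' - E) \<union> (U - U')))"
      using meas by (intro emeasure_mono) auto
    moreover have "\<dots> \<le> emeasure W E + emeasure W ((U' - E) \<union> (U - U'))"
      using meas by (intro emeasure_subadditive) auto
    moreover have "emeasure W ((U' - E) \<union> (U - U')) \<le> emeasure W (U' - E) + emeasure W (U - U')"
      using meas by (intro emeasure_subadditive) auto
    ultimately have "emeasure W U \<le> emeasure W E + (ennreal (\<beta> * D^(k+m)) * emeasure W U
       + ennreal ((DIM('a) + C) * D^m * \<theta>^k) * emeasure W U)"
      by (meson add_left_mono add_mono order_trans)
    also have "ennreal (\<beta> * D^(k+m)) * emeasure W U + ennreal ((DIM('a) + C) * D^m * \<theta>^k) * emeasure W U
        = ennreal \<eta> * emeasure W U"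
      using \<beta> D C_pos \<theta> unfolding \<eta>_def distrib_right[symmetric]
      by (subst ennreal_plus[symmetric]) (auto simp: power_add mult_ac)
    finally have main: "emeasure W U \<le> emeasure W E + ennreal \<eta> * emeasure W U" .
    have "emeasure W U \<le> (\<Sum>p\<in>K. emeasure W (open_cube (fst p) (snd p)))"
      unfolding U_def using K by (intro emeasure_subadditive_finite) (auto simp: sets_W)
    also have "\<dots> < \<infinity>" using finite_open_cube by (simp add: less_top[symmetric] ennreal_sum_less_top K)
    finally obtain a where a: "a \<ge> 0" "emeasure W U = ennreal a"
      by (cases "emeasure W U") auto
    have "emeasure W U \<le> ennreal (1 + 2 * \<eta>) * emeasure W E"
    proof (cases "emeasure W E")
      case (real e)
      have "ennreal a \<le> ennreal (e + \<eta> * a)"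
        using main a real \<eta> by (simp add: ennreal_mult)
      then have "a \<le> e + \<eta> * a" using a real \<eta> by (subst (asm) ennreal_le_iff) auto
      then have "(1 - \<eta>) * a \<le> e" by (simp add: algebra_simps)
      then have "(1 + 2 * \<eta>) * ((1 - \<eta>) * a) \<le> (1 + 2 * \<eta>) * e"
        using \<eta> by (intro mult_left_mono) auto
      \<comment> \<open>The product \<open>(1 + 2 * \<eta>) * (1 - \<eta>)\<close> exceeds 1 by
        exactly \<open>\<eta> * (1 - 2 * \<eta>)\<close>.\<close>
      moreover have "0 \<le> \<eta> * (1 - 2 * \<eta>) * a" using \<eta> a by simp
      then have "a \<le> (1 + 2 * \<eta>) * ((1 - \<eta>) * a)" by (simp add: algebra_simps)
      ultimately have "ennreal a \<le> ennreal ((1 + 2 * \<eta>) * e)" by (intro ennreal_leI) linarith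
      then show ?thesis using a real \<eta> by (simp add: ennreal_mult)
    next
      case top
      then show ?thesis using \<eta> by (simp add: ennreal_mult_top)
    qed
    then show ?thesis unfolding U_def \<eta>_def .
  qed
  note bound = this
  show ?thesis
  proof (rule that[of "D^m" D "(DIM('a) + C) * D^m"])
    show "0 \<le> D^m" "1 \<le> D" "0 \<le> (DIM('a) + C) * D^m" using D(1) C_pos by simp_all
  qed (rule bound; assumption)
qed

lemma halo_bound:
  obtains A D B where "A \<ge> 0" "D \<ge> 1" "B \<ge> 0"
    "\<And>E \<beta> K k. \<lbrakk>E \<in> sets lebesgue; \<beta> \<ge> 0;
      \<forall>p\<in>K. 0 < snd p \<and> emeasure W (open_cube (fst p) (snd p) - E) \<le> ennreal \<beta> * emeasure W (open_cube (fst p) (snd p));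
      \<beta> * A * D^k + B * \<theta>^k \<le> 1/2\<rbrakk> \<Longrightarrow>
      emeasure W (\<Union>p\<in>K. open_cube (fst p) (snd p)) \<le> ennreal (1 + 2 * (\<beta> * A * D^k + B * \<theta>^k)) * emeasure W E"
proof (rule finite_halo_bound)
  fix A D B assume ADB: "A \<ge> 0" "D \<ge> 1" "B \<ge> 0"
    and fin: "\<And>E \<beta> K k. \<lbrakk>E \<in> sets lebesgue; \<beta> \<ge> 0; finite K;
      \<forall>p\<in>K. 0 < snd p \<and> emeasure W (open_cube (fst p) (snd p) - E) \<le> ennreal \<beta> * emeasure W (open_cube (fst p) (snd p));
      \<beta> * A * D^k + B * \<theta>^k \<le> 1/2\<rbrakk> \<Longrightarrow>
      emeasure W (\<Union>p\<in>K. open_cube (fst p) (snd p)) \<le> ennreal (1 + 2 * (\<beta> * A * D^k + B * \<theta>^k)) * emeasure W E"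
  have "emeasure W (\<Union>p\<in>K. open_cube (fst p) (snd p)) \<le> ennreal (1 + 2 * (\<beta> * A * D^k + B * \<theta>^k)) * emeasure W E"
    if E: "E \<in> sets lebesgue" and \<beta>: "\<beta> \<ge> 0"
      and K: "\<forall>p\<in>K. 0 < snd p \<and> emeasure W (open_cube (fst p) (snd p) - E) \<le> ennreal \<beta> * emeasure W (open_cube (fst p) (snd p))"
      and half: "\<beta> * A * D^k + B * \<theta>^k \<le> 1/2" for E \<beta> K k
  proof -
    show ?thesis
    proof (rule emeasure_UN_open_le)
      show "sets borel \<subseteq> sets W" by (auto simp: sets_W)
      fix J assume J: "finite J" "J \<subseteq> K"
      show "emeasure W (\<Union>p\<in>J. open_cube (fst p) (snd p)) \<le> ennreal (1 + 2 * (\<beta> * A * D^k + B * \<theta>^k)) * emeasure W E"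
        using K J(2) by (intro fin[OF E \<beta> J(1) _ half]) blast
    qed simp
  qed
  note bound = this
  show thesis
  proof (rule that[of A D B])
    show "0 \<le> A" "1 \<le> D" "0 \<le> B" by (fact ADB)+
  qed (rule bound; assumption)
qed

end

section \<open>Balancing the inner error against the boundary error\<close>

text \<open>Choosing \<open>k\<close> so that \<open>D^k\<close> is about
  \<open>\<beta> powr (-1/2)\<close> makes the first term of order \<open>\<beta> powr (1/2)\<close>
  and the second a positive power of \<open>\<beta>\<close>.\<close>

lemma optimal_level:
  fixes A B D \<theta> :: real
  assumes "A \<ge> 0" "B \<ge> 0" "D > 1" "0 < \<theta>" "\<theta> < 1"
  shows "\<exists>C c. C > 0 \<and> c > 0 \<and> (\<forall>\<beta>. 0 < \<beta> \<longrightarrow> \<beta> < 1 \<longrightarrow> (\<exists>k::nat. \<beta> * A * D^k + B * \<theta>^k \<le> C * \<beta> powr c))"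
proof -
  \<comment> \<open>Chosen so that \<open>\<theta> powr x = \<beta> powr e\<close> for the ideal
    real level \<open>x\<close> below; rounding \<open>x\<close> down costs the factor
    \<open>1 / \<theta>\<close>.\<close>
  define e where "e = ln (1/\<theta>) / (2 * ln D)"
  define c where "c = min (1/2) e"
  have lnD: "ln D > 0" using assms by simp
  have e: "e > 0" using assms lnD unfolding e_def by (intro divide_pos_pos ln_gt_zero) auto
  have "\<exists>k::nat. \<beta> * A * D^k + B * \<theta>^k \<le> (A + B / \<theta> + 1) * \<beta> powr c" if \<beta>: "0 < \<beta>" "\<beta> < 1" for \<beta>
  proof -
    define x where "x = ln (1/\<beta>) / (2 * ln D)"
    have x: "x \<ge> 0" using \<beta> lnD unfolding x_def by (intro divide_nonneg_pos ln_ge_zero) auto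
    define k where "k = nat \<lfloor>x\<rfloor>"
    have k: "real k \<le> x" "x - 1 \<le> real k" using x unfolding k_def by linarith+
    have "D ^ k = D powr k" using assms by (simp add: powr_realpow)
    also have "\<dots> \<le> D powr x" using k assms by (intro powr_mono) auto
    also have "\<dots> = \<beta> powr (-1/2)"
      using assms \<beta> lnD by (simp add: powr_def x_def ln_div)
    finally have "\<beta> * D^k \<le> \<beta> powr 1 * \<beta> powr (-1/2)" using \<beta> by (simp add: mult_left_mono)
    also have "\<dots> = \<beta> powr (1/2)" by (subst powr_add[symmetric]) simp
    also have "\<dots> \<le> \<beta> powr c" using \<beta> by (intro powr_mono') (auto simp: c_def)
    finally have 1: "A * (\<beta> * D^k) \<le> A * \<beta> powr c" using assms by (intro mult_left_mono) auto
    have "\<theta> ^ k = \<theta> powr k" using assms by (simp add: powr_realpow)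
    also have "\<dots> \<le> \<theta> powr (x - 1)" using k assms by (intro powr_mono') auto
    also have "\<dots> = \<beta> powr e / \<theta>"
      using assms \<beta> lnD by (simp add: powr_diff) (simp add: powr_def x_def e_def ln_div field_simps)
    also have "\<dots> \<le> \<beta> powr c / \<theta>" using \<beta> assms by (intro divide_right_mono powr_mono') (auto simp: c_def)
    finally have 2: "B * \<theta>^k \<le> B * (\<beta> powr c / \<theta>)" using assms by (intro mult_left_mono) auto
    have "\<beta> * A * D^k + B * \<theta>^k \<le> (A + B / \<theta> + 1) * \<beta> powr c"
    proof -
      have "\<beta> * A * D^k + B * \<theta>^k = A * (\<beta> * D^k) + B * \<theta>^k" by simp
      also have "\<dots> \<le> A * \<beta> powr c + B * (\<beta> powr c / \<theta>)" using 1 2 by (rule add_mono)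
      also have "\<dots> \<le> (A + B / \<theta> + 1) * \<beta> powr c" by (simp add: algebra_simps)
      finally show ?thesis .
    qed
    then show ?thesis ..
  qed
  moreover have "A + B / \<theta> + 1 > 0" using assms by (simp add: add_nonneg_pos)
  moreover have "c > 0" using e by (simp add: c_def)
  ultimately show ?thesis by blast
qed

section \<open>From halo bounds to Tauberian constants\<close>

abbreviation weighted :: "('a::euclidean_space \<Rightarrow> real) \<Rightarrow> 'a measure" where
  "weighted w \<equiv> density lebesgue (\<lambda>x. ennreal (w x))"

text \<open>A weight is only known to be integrable on compact sets; its truncations to growing
  balls are measurable and at each point eventually equal to \<open>w\<close>.\<close>

lemma weight_measurable:
  fixes w :: "'a::euclidean_space \<Rightarrow> real"
  assumes "is_weight w"
  shows "w \<in> borel_measurable lebesgue"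
proof (rule borel_measurable_LIMSEQ_real)
  show "(\<lambda>x. indicator (cball 0 (real n)) x *\<^sub>R w x) \<in> borel_measurable lebesgue" for n
    using assms unfolding is_weight_def set_integrable_def by (blast intro: borel_measurable_integrable compact_cball)
  fix x :: 'a
  obtain N :: nat where "norm x \<le> N" using real_arch_simple by blast
  then have "\<forall>\<^sub>F n in sequentially. indicator (cball 0 (real n)) x *\<^sub>R w x = w x"
    by (intro eventually_sequentiallyI[of N]) (auto simp: indicator_def)
  then show "(\<lambda>n. indicator (cball 0 (real n)) x *\<^sub>R w x) \<longlonglongrightarrow> w x"
    by (rule tendsto_eventually)
qed

lemma wmeas_eq_emeasure:
  assumes "is_weight w" "E \<in> sets lebesgue"
  shows "wmeas w E = emeasure (weighted w) E"
  unfolding wmeas_def using weight_measurable[OF assms(1)] assms(2)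
  by (subst emeasure_density) auto

lemma emeasure_weighted_open_cube_finite:
  assumes "is_weight w"
  shows "emeasure (weighted w) (open_cube c r) < \<infinity>"
proof -
  let ?K = "cbox (c - r *\<^sub>R One) (c + r *\<^sub>R One)"
  have "integrable lebesgue (\<lambda>x. indicator ?K x *\<^sub>R w x)"
    using assms compact_cbox unfolding is_weight_def set_integrable_def by blast
  then have "(\<integral>\<^sup>+x. ennreal (norm (indicator ?K x *\<^sub>R w x)) \<partial>lebesgue) < \<infinity>"
    by (simp add: integrable_iff_bounded)
  also have "(\<integral>\<^sup>+x. ennreal (norm (indicator ?K x *\<^sub>R w x)) \<partial>lebesgue) = (\<integral>\<^sup>+x\<in>?K. ennreal (w x) \<partial>lebesgue)"
    using assms by (intro nn_integral_cong) (auto simp: is_weight_def split: split_indicator)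
  also have "\<dots> = emeasure (weighted w) ?K"
    using weight_measurable[OF assms] by (subst emeasure_density) auto
  finally have "emeasure (weighted w) ?K < \<infinity>" .
  moreover have "emeasure (weighted w) (open_cube c r) \<le> emeasure (weighted w) ?K"
    unfolding open_cube_eq_box by (intro emeasure_mono box_subset_cbox) auto
  ultimately show ?thesis by (rule le_less_trans[rotated])
qed

text \<open>A supremum exceeds \<open>\<alpha>\<close> exactly when one of its members does. The
  result is a union of open cubes, the form to which the halo bound applies.\<close>

lemma wmaxop_indicator_level:
  assumes w: "is_weight w" and E: "E \<in> sets lebesgue"
  shows "{x. ennreal \<alpha> < wmaxop w (indicator E) x} =
    (\<Union>p\<in>{p. 0 < snd p \<and> ennreal \<alpha> < emeasure (weighted w) (E \<inter> open_cube (fst p) (snd p)) / emeasure (weighted w) (open_cube (fst p) (snd p))}.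
      open_cube (fst p) (snd p))" (is "_ = ?U")
proof -
  have "(\<integral>\<^sup>+ y\<in>Q. ennreal (\<bar>indicator E y\<bar> * w y) \<partial>lebesgue) / wmeas w Q =
      emeasure (weighted w) (E \<inter> Q) / emeasure (weighted w) Q" if "is_cube Q" for Q
  proof -
    have Q: "Q \<in> sets lebesgue" using that unfolding is_cube_iff_open_cube by auto
    have "(\<integral>\<^sup>+ y\<in>Q. ennreal (\<bar>indicator E y\<bar> * w y) \<partial>lebesgue) = (\<integral>\<^sup>+ y. ennreal (w y) * indicator (E \<inter> Q) y \<partial>lebesgue)"
      by (intro nn_integral_cong) (auto split: split_indicator)
    also have "\<dots> = emeasure (weighted w) (E \<inter> Q)"
      using weight_measurable[OF w] E Q by (subst emeasure_density) auto
    finally show ?thesis by (simp add: wmeas_eq_emeasure[OF w Q])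
  qed
  then have "x \<in> ?U \<longleftrightarrow> ennreal \<alpha> < wmaxop w (indicator E) x" for x
    unfolding wmaxop_def less_SUP_iff by (auto simp: is_cube_iff_open_cube)
  then show ?thesis by blast
qed

lemma emeasure_diff_le_of_density:
  assumes Q: "Q \<in> sets M" "E \<in> sets M" "emeasure M Q < \<infinity>" and \<alpha>: "0 \<le> \<alpha>" "\<alpha> \<le> 1"
    and less: "ennreal \<alpha> < emeasure M (E \<inter> Q) / emeasure M Q"
  shows "emeasure M (Q - E) \<le> ennreal (1 - \<alpha>) * emeasure M Q"
proof -
  obtain q where q: "q \<ge> 0" "emeasure M Q = ennreal q" using Q(3) by (cases "emeasure M Q") auto
  have "emeasure M (E \<inter> Q) \<le> emeasure M Q" using Q by (intro emeasure_mono) auto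
  then obtain e where e: "e \<ge> 0" "emeasure M (E \<inter> Q) = ennreal e"
    using q by (cases "emeasure M (E \<inter> Q)") (auto simp: top_unique)
  have "emeasure M (Q - E) = emeasure M Q - emeasure M (E \<inter> Q)"
    using Q e by (subst emeasure_Diff[symmetric]) (auto intro!: arg_cong2[where f=emeasure])
  also have "\<dots> = ennreal (q - e)" using q e by (simp add: ennreal_minus)
  also have "\<dots> \<le> ennreal ((1 - \<alpha>) * q)"
  proof (cases "q = 0")
    case True
    then show ?thesis using e by (simp add: ennreal_neg)
  next
    case False
    then have "\<alpha> < e / q" using less q e \<alpha> by (simp add: divide_ennreal ennreal_less_iff)
    then have "\<alpha> * q < e" using False q by (simp add: pos_less_divide_eq)
    then show ?thesis by (intro ennreal_leI) (simp add: algebra_simps)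
  qed
  also have "\<dots> = ennreal (1 - \<alpha>) * emeasure M Q" using q \<alpha> by (simp add: ennreal_mult)
  finally show ?thesis .
qed

lemma tauberian_le_of_power_bounded:
  fixes w :: "'a::euclidean_space \<Rightarrow> real"
  assumes w: "is_weight w" and pb: "power_bounded_measure (weighted w) C \<theta>"
  shows "\<exists>C c. C > 0 \<and> c > 0 \<and>
    (\<forall>\<^sub>F \<alpha> in at_left 1. tauberian w \<alpha> \<le> ennreal (1 + C * (1 - \<alpha>) powr c))"
proof -
  interpret power_bounded_measure "weighted w" C \<theta> by (rule pb)
  let ?W = "weighted w"
  show ?thesis
  proof (rule halo_bound)
    fix A D B assume ADB: "0 \<le> A" "1 \<le> D" "0 \<le> B"
      and halo: "\<And>E \<beta> K k. \<lbrakk>E \<in> sets lebesgue; \<beta> \<ge> 0;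
        \<forall>p\<in>K. 0 < snd p \<and> emeasure ?W (open_cube (fst p) (snd p) - E) \<le> ennreal \<beta> * emeasure ?W (open_cube (fst p) (snd p));
        \<beta> * A * D^k + B * \<theta>^k \<le> 1/2\<rbrakk> \<Longrightarrow>
        emeasure ?W (\<Union>p\<in>K. open_cube (fst p) (snd p)) \<le> ennreal (1 + 2 * (\<beta> * A * D^k + B * \<theta>^k)) * emeasure ?W E"
    \<comment> \<open>Level selection needs a base strictly above 1, whereas \<open>D\<close> may
      equal 1; hence \<open>D + 1\<close>.\<close>
    obtain C0 c where C0: "C0 > 0" "c > 0"
      and level: "\<And>\<beta>. 0 < \<beta> \<Longrightarrow> \<beta> < 1 \<Longrightarrow> \<exists>k::nat. \<beta> * A * (D + 1)^k + B * \<theta>^k \<le> C0 * \<beta> powr c"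
      using optimal_level[of A B "D + 1" \<theta>] ADB \<theta> by auto
    \<comment> \<open>Beyond this threshold \<open>C0 * (1 - \<alpha>) powr c\<close> is at most
      1/2, as the halo bound requires; the maximum with 0 ensures
      \<open>1 - \<alpha> < 1\<close>.\<close>
    define \<alpha>0 where "\<alpha>0 = max 0 (1 - (1 / (2 * C0)) powr (1 / c))"
    have "tauberian w \<alpha> \<le> ennreal (1 + (2 * C0) * (1 - \<alpha>) powr c)" if \<alpha>: "\<alpha>0 < \<alpha>" "\<alpha> < 1" for \<alpha>
    proof -
      have \<beta>: "0 < 1 - \<alpha>" "1 - \<alpha> < 1" "1 - \<alpha> \<le> (1 / (2 * C0)) powr (1 / c)"
        using \<alpha> by (auto simp: \<alpha>0_def)
      have "(1 - \<alpha>) powr c \<le> ((1 / (2 * C0)) powr (1 / c)) powr c"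
        using \<beta> C0 by (intro powr_mono2) auto
      also have "\<dots> = 1 / (2 * C0)" using C0 by (simp add: powr_powr)
      finally have "C0 * (1 - \<alpha>) powr c \<le> C0 * (1 / (2 * C0))" using C0 by (intro mult_left_mono) auto
      then have half: "C0 * (1 - \<alpha>) powr c \<le> 1/2" using C0 by simp
      obtain k where k: "(1 - \<alpha>) * A * (D + 1)^k + B * \<theta>^k \<le> C0 * (1 - \<alpha>) powr c"
        using level[OF \<beta>(1,2)] by blast
      have "D^k \<le> (D + 1)^k" using ADB by (intro power_mono) auto
      then have "(1 - \<alpha>) * A * D^k \<le> (1 - \<alpha>) * A * (D + 1)^k"
        using \<beta> ADB by (intro mult_left_mono) auto
      with k have k': "(1 - \<alpha>) * A * D^k + B * \<theta>^k \<le> C0 * (1 - \<alpha>) powr c" by simp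
      show ?thesis
        unfolding tauberian_def
      proof (rule SUP_least)
        fix E assume "E \<in> {E \<in> sets lebesgue. 0 < wmeas w E \<and> wmeas w E < \<infinity>}"
        then have E: "E \<in> sets lebesgue" "0 < wmeas w E" by auto
        define K where "K = {p::'a \<times> real. 0 < snd p \<and>
          ennreal \<alpha> < emeasure ?W (E \<inter> open_cube (fst p) (snd p)) / emeasure ?W (open_cube (fst p) (snd p))}"
        have U: "{x. ennreal \<alpha> < wmaxop w (indicator E) x} = (\<Union>p\<in>K. open_cube (fst p) (snd p))"
          unfolding K_def by (rule wmaxop_indicator_level[OF w E(1)])
        have "open (\<Union>p\<in>K. open_cube (fst p) (snd p))" by auto
        then have meas: "(\<Union>p\<in>K. open_cube (fst p) (snd p)) \<in> sets lebesgue"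
          using borel_open by auto
        have "\<forall>p\<in>K. 0 < snd p \<and> emeasure ?W (open_cube (fst p) (snd p) - E) \<le> ennreal (1 - \<alpha>) * emeasure ?W (open_cube (fst p) (snd p))"
        proof (intro ballI conjI)
          fix p assume p: "p \<in> K"
          then show "0 < snd p" by (simp add: K_def)
          show "emeasure ?W (open_cube (fst p) (snd p) - E) \<le> ennreal (1 - \<alpha>) * emeasure ?W (open_cube (fst p) (snd p))"
            using p \<beta> E finite_open_cube by (intro emeasure_diff_le_of_density) (auto simp: K_def)
        qed
        then have "emeasure ?W (\<Union>p\<in>K. open_cube (fst p) (snd p)) \<le>
            ennreal (1 + 2 * ((1 - \<alpha>) * A * D^k + B * \<theta>^k)) * emeasure ?W E"
          using \<beta> k' half by (intro halo E(1)) auto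
        also have "\<dots> \<le> ennreal (1 + 2 * C0 * (1 - \<alpha>) powr c) * emeasure ?W E"
          using k' by (intro mult_right_mono ennreal_leI) auto
        finally have "emeasure ?W (\<Union>p\<in>K. open_cube (fst p) (snd p)) \<le> emeasure ?W E * ennreal (1 + 2 * C0 * (1 - \<alpha>) powr c)"
          by (simp add: mult.commute)
        then show "wmeas w {x. ennreal \<alpha> < wmaxop w (indicator E) x} / wmeas w E \<le> ennreal (1 + 2 * C0 * (1 - \<alpha>) powr c)"
          unfolding U using E meas by (intro divide_le_posI_ennreal) (simp_all add: wmeas_eq_emeasure[OF w])
      qed
    qed
    moreover have "\<alpha>0 < 1" using C0 by (simp add: \<alpha>0_def)
    ultimately have "\<forall>\<^sub>F \<alpha> in at_left 1. tauberian w \<alpha> \<le> ennreal (1 + (2 * C0) * (1 - \<alpha>) powr c)"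
      unfolding eventually_at_left_field by blast
    then show ?thesis using C0 by (intro exI[of _ "2 * C0"] exI[of _ c]) simp
  qed
qed

section \<open>Dyadic cells and stopping times\<close>

lemma ennreal_le_mult_of_divide_le:
  fixes a b c :: ennreal
  assumes "a / b \<le> c" "b \<noteq> 0" "b \<noteq> top"
  shows "a \<le> c * b"
proof -
  have "a = a * b / b" using assms by (simp add: ennreal_mult_divide_eq)
  also have "\<dots> = (a / b) * b" by (simp add: ennreal_times_divide mult.commute)
  also have "\<dots> \<le> c * b" using assms by (intro mult_right_mono) auto
  finally show ?thesis .
qed

locale dyadic_grid =
  fixes a :: "'a::euclidean_space" and l :: real
  assumes l_pos: "l > 0"
begin

text \<open>
  The cells are half-open cubes, so that each level is a partition of the space.
\<close>

definition grid_index :: "nat \<Rightarrow> 'a \<Rightarrow> 'a \<Rightarrow> int" where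
  "grid_index k x b = \<lfloor>2^k * ((x - a) \<bullet> b) / l\<rfloor>"

definition cell :: "nat \<Rightarrow> 'a \<Rightarrow> 'a set" where
  "cell k x = {y. \<forall>b\<in>Basis. grid_index k y b = grid_index k x b}"

definition radius :: "nat \<Rightarrow> real" where
  "radius k = l / 2^k / 2"

definition centre :: "nat \<Rightarrow> 'a \<Rightarrow> 'a" where
  "centre k x = a + (\<Sum>b\<in>Basis. ((grid_index k x b + 1/2) * (l / 2^k)) *\<^sub>R b)"

lemma radius_pos: "radius k > 0"
  using l_pos by (simp add: radius_def)

lemma cell_self: "x \<in> cell k x"
  by (simp add: cell_def)

lemma cell_eq: "y \<in> cell k x \<Longrightarrow> cell k y = cell k x"
  by (auto simp: cell_def)

text \<open>Halving commutes with the floor up to integer division, so every generation of cells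
  refines the previous one.\<close>

lemma grid_index_Suc: "grid_index k x b = grid_index (Suc k) x b div 2"
proof -
  have "2^k * ((x - a) \<bullet> b) / l = 2^Suc k * ((x - a) \<bullet> b) / l / real_of_int 2" by simp
  moreover have "\<lfloor>2^Suc k * ((x - a) \<bullet> b) / l / real_of_int 2\<rfloor> = \<lfloor>2^Suc k * ((x - a) \<bullet> b) / l\<rfloor> div 2"
    by (rule floor_divide_real_eq_div) simp
  ultimately show ?thesis by (simp only: grid_index_def)
qed

lemma cell_antimono: "j \<le> k \<Longrightarrow> cell k x \<subseteq> cell j x"
proof (induction k rule: dec_induct)
  case (step n)
  have "cell (Suc n) x \<subseteq> cell n x" unfolding cell_def by (auto simp: grid_index_Suc[of n])
  with step show ?case by blast
qed simp

text \<open>Serves to match the root cell with a prescribed open cube.\<close>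

lemma centre_0: "centre 0 (a + (l/2) *\<^sub>R One) = a + (l/2) *\<^sub>R One"
proof -
  have "grid_index 0 (a + (l/2) *\<^sub>R One) b = 0" if "b \<in> Basis" for b
    using that l_pos by (simp add: grid_index_def)
  then have "centre 0 (a + (l/2) *\<^sub>R One) = a + (\<Sum>b\<in>Basis. (l/2) *\<^sub>R b)"
    unfolding centre_def by simp
  then show ?thesis by (simp only: scaleR_sum_right)
qed

lemma cell_iff: "y \<in> cell k x \<longleftrightarrow> (\<forall>b\<in>Basis. - radius k \<le> (y - centre k x) \<bullet> b \<and> (y - centre k x) \<bullet> b < radius k)"
proof -
  have "grid_index k y b = grid_index k x b \<longleftrightarrow> - radius k \<le> (y - centre k x) \<bullet> b \<and> (y - centre k x) \<bullet> b < radius k"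
    if b: "b \<in> Basis" for b
  proof -
    define h where "h = l / 2^k"
    have h: "h > 0" using l_pos by (simp add: h_def)
    define t where "t = (y - a) \<bullet> b"
    have "(y - centre k x) \<bullet> b = t - (grid_index k x b + 1/2) * h"
      using b by (simp add: centre_def h_def t_def inner_diff_left inner_add_left inner_sum_left inner_Basis if_distrib[of "\<lambda>z. _ * z"] sum.delta cong: if_cong)
    moreover have "grid_index k y b = grid_index k x b \<longleftrightarrow> real_of_int (grid_index k x b) \<le> t / h \<and> t / h < real_of_int (grid_index k x b) + 1"
      unfolding grid_index_def[of k y] t_def[symmetric] using h_def by (auto simp: floor_eq_iff mult.commute)
    moreover have "real_of_int (grid_index k x b) \<le> t / h \<longleftrightarrow> - (h/2) \<le> t - (grid_index k x b + 1/2) * h"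
      using h by (simp add: pos_le_divide_eq algebra_simps)
    moreover have "t / h < real_of_int (grid_index k x b) + 1 \<longleftrightarrow> t - (grid_index k x b + 1/2) * h < h/2"
    proof -
      have "(real_of_int (grid_index k x b) + 1) * h = (grid_index k x b + 1/2) * h + h/2" by (simp add: algebra_simps)
      then show ?thesis using h by (subst pos_divide_less_eq) auto
    qed
    ultimately show ?thesis by (simp add: radius_def h_def)
  qed
  then show ?thesis by (auto simp: cell_def)
qed

lemma open_cube_subset_cell: "open_cube (centre k x) (radius k) \<subseteq> cell k x"
proof
  fix y assume "y \<in> open_cube (centre k x) (radius k)"
  then have "\<bar>(y - centre k x) \<bullet> b\<bar> < radius k" if "b \<in> Basis" for b
    using that by (simp add: open_cube_def infnorm_less_iff)
  then show "y \<in> cell k x" unfolding cell_iff by (fastforce simp: abs_less_iff)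
qed

lemma cell_subset_open_cube: "radius k < s \<Longrightarrow> cell k x \<subseteq> open_cube (centre k x) s"
  by (fastforce simp: cell_iff open_cube_def infnorm_less_iff abs_less_iff)

lemma cell_subset_cbox: "cell k x \<subseteq> cbox (centre k x - radius k *\<^sub>R One) (centre k x + radius k *\<^sub>R One)"
  by (fastforce simp: cell_iff mem_box inner_diff_left inner_add_left)

lemma cell_borel: "cell k x \<in> sets borel"
proof -
  have "cell k x = {y. \<forall>b\<in>Basis. - radius k \<le> (y - centre k x) \<bullet> b \<and> (y - centre k x) \<bullet> b < radius k}"
    using cell_iff by blast
  also have "\<dots> \<in> sets borel" by measurable
  finally show ?thesis .
qed

lemma cell_lebesgue [simp]: "cell k x \<in> sets lebesgue"
  using cell_borel by simp

lemma emeasure_cell: "emeasure lebesgue (cell k x) = ennreal ((2 * radius k) ^ DIM('a))"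
proof (rule antisym)
  have "emeasure lebesgue (cell k x) \<le> emeasure lebesgue (cbox (centre k x - radius k *\<^sub>R One) (centre k x + radius k *\<^sub>R One))"
    using cell_subset_cbox by (intro emeasure_mono) auto
  also have "\<dots> = ennreal ((2 * radius k) ^ DIM('a))"
    using radius_pos[of k] by (simp add: emeasure_lborel_cbox_eq inner_diff_left inner_add_left)
  finally show "emeasure lebesgue (cell k x) \<le> ennreal ((2 * radius k) ^ DIM('a))" .
  show "ennreal ((2 * radius k) ^ DIM('a)) \<le> emeasure lebesgue (cell k x)"
    using emeasure_mono[OF open_cube_subset_cell cell_lebesgue, of k x] radius_pos[of k]
    by (simp add: emeasure_open_cube less_imp_le)
qed

text \<open>The cell and the open cube inside it have the same finite volume. This is the passage
  between the half-open cells and the open cubes of \<open>is_cube\<close>.\<close>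

lemma cell_diff_open_cube_null: "cell k x - open_cube (centre k x) (radius k) \<in> null_sets lebesgue"
proof -
  have "emeasure lebesgue (cell k x - open_cube (centre k x) (radius k)) = 0"
    using open_cube_subset_cell[of k x] radius_pos[of k]
    by (subst emeasure_Diff) (auto simp: emeasure_cell emeasure_open_cube less_imp_le simp del: emeasure_completion)
  then show ?thesis by (rule null_setsI) (intro sets.Diff cell_lebesgue open_cube_sets)
qed

lemma cell_subset_open:
  assumes "open U" "x \<in> U"
  shows "\<exists>k. cell k x \<subseteq> U"
proof -
  obtain e where e: "e > 0" "ball x e \<subseteq> U" using assms by (meson open_contains_ball)
  define d where "d = sqrt DIM('a) * l"
  have "d > 0" using l_pos by (simp add: d_def)
  then obtain k where k: "(1/2)^k < e / d" using real_arch_pow_inv[of "e / d" "1/2"] e by auto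
  have "cell k x \<subseteq> open_cube x (l / 2^k)"
  proof
    fix y assume y: "y \<in> cell k x"
    have "\<bar>(y - x) \<bullet> b\<bar> < l / 2^k" if b: "b \<in> Basis" for b
    proof -
      have "(y - x) \<bullet> b = (y - centre k x) \<bullet> b - (x - centre k x) \<bullet> b" by (simp add: inner_diff_left)
      moreover have "- radius k \<le> (y - centre k x) \<bullet> b \<and> (y - centre k x) \<bullet> b < radius k"
        "- radius k \<le> (x - centre k x) \<bullet> b \<and> (x - centre k x) \<bullet> b < radius k"
        using y cell_self[of x k] b unfolding cell_iff by blast+
      ultimately have "\<bar>(y - x) \<bullet> b\<bar> < 2 * radius k" by linarith
      then show ?thesis by (simp add: radius_def)
    qed
    then show "y \<in> open_cube x (l / 2^k)" by (simp add: open_cube_def infnorm_less_iff)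
  qed
  also have "\<dots> \<subseteq> ball x (sqrt DIM('a) * (l / 2^k))" by (rule open_cube_subset_ball)
  also have "\<dots> \<subseteq> ball x e"
  proof (rule subset_ball)
    have "sqrt DIM('a) * (l / 2^k) = (1/2)^k * d" by (simp add: d_def power_one_over)
    also have "\<dots> \<le> e" using k \<open>d > 0\<close> by (simp add: pos_less_divide_eq)
    finally show "sqrt DIM('a) * (l / 2^k) \<le> e" .
  qed
  finally show ?thesis using e by blast
qed

text \<open>Every cell contains an open cube and thus a point of a countable dense set, which
  determines the cell.\<close>

lemma countable_cells: "countable (range (cell k))"
proof -
  obtain D :: "'a set" where D: "countable D" "\<And>X. open X \<Longrightarrow> X \<noteq> {} \<Longrightarrow> \<exists>d\<in>D. d \<in> X"
    by (rule countable_dense_setE) blast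
  have "range (cell k) \<subseteq> cell k ` D"
  proof safe
    fix x
    have "centre k x \<in> open_cube (centre k x) (radius k)" using radius_pos by (simp add: open_cube_def infnorm_0)
    then obtain d where "d \<in> D" "d \<in> open_cube (centre k x) (radius k)"
      using D(2)[of "open_cube (centre k x) (radius k)"] by auto
    then have "d \<in> D" "cell k x = cell k d" using open_cube_subset_cell cell_eq by (blast, metis subsetD open_cube_subset_cell cell_eq)
    then show "cell k x \<in> cell k ` D" by blast
  qed
  then show ?thesis using D(1) by (meson countable_image countable_subset)
qed

section \<open>Stopping cells\<close>

text \<open>The least generation gives the largest cell at \<open>x\<close> with the property, as in
  a Calderon-Zygmund decomposition. The value is meaningful only if some cell at \<open>x\<close>
  has the property.\<close>

definition stop :: "('a set \<Rightarrow> bool) \<Rightarrow> 'a \<Rightarrow> 'a set" where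
  "stop \<Phi> x = cell (LEAST k. \<Phi> (cell k x)) x"

lemma stop_self: "x \<in> stop \<Phi> x"
  by (simp add: stop_def cell_self)

lemma stop_sat: "\<exists>k. \<Phi> (cell k x) \<Longrightarrow> \<Phi> (stop \<Phi> x)"
  unfolding stop_def by (rule LeastI_ex)

lemma cell_subset_stop: "\<Phi> (cell k x) \<Longrightarrow> cell k x \<subseteq> stop \<Phi> x"
  unfolding stop_def by (intro cell_antimono Least_le)

text \<open>By nesting, \<open>x\<close> and \<open>y\<close> share all cells up to the stopping
  generation of \<open>x\<close>, so the search for the least generation ends at the same place.
  Hence stopping cells are equal or disjoint.\<close>

lemma stop_eq:
  assumes x: "\<exists>k. \<Phi> (cell k x)" and y: "y \<in> stop \<Phi> x"
  shows "stop \<Phi> y = stop \<Phi> x"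
proof -
  define m where "m = (LEAST k. \<Phi> (cell k x))"
  have m: "\<Phi> (cell m x)" unfolding m_def using x by (rule LeastI_ex)
  have eq: "cell j y = cell j x" if "j \<le> m" for j
    using y cell_antimono[OF that, of x] by (intro cell_eq) (auto simp: stop_def m_def)
  have "(LEAST k. \<Phi> (cell k y)) = m"
  proof (rule Least_equality)
    show "\<Phi> (cell m y)" using m eq by simp
    fix k assume k: "\<Phi> (cell k y)"
    show "m \<le> k"
    proof (rule ccontr)
      assume "\<not> m \<le> k"
      then have "k < m" "\<Phi> (cell k x)" using k eq[of k] by auto
      then show False unfolding m_def using not_less_Least by blast
    qed
  qed
  then show ?thesis using eq[of m] by (simp add: stop_def m_def)
qed

lemma countable_stop: "countable (stop \<Phi> ` X)"
proof (rule countable_subset)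
  show "stop \<Phi> ` X \<subseteq> (\<Union>k. range (cell k))" by (auto simp: stop_def)
  show "countable (\<Union>k. range (cell k))" using countable_cells by blast
qed

lemma stop_lebesgue: "stop \<Phi> x \<in> sets lebesgue"
  by (simp add: stop_def)

lemma disjoint_stop:
  assumes "\<And>x. x \<in> X \<Longrightarrow> \<exists>k. \<Phi> (cell k x)"
  shows "disjoint_family_on (\<lambda>P. P) (stop \<Phi> ` X)"
  unfolding disjoint_family_on_def
proof (intro ballI impI)
  fix P P' assume P: "P \<in> stop \<Phi> ` X" "P' \<in> stop \<Phi> ` X" "P \<noteq> P'"
  then obtain x x' where "x \<in> X" "x' \<in> X" "P = stop \<Phi> x" "P' = stop \<Phi> x'" by blast
  then show "P \<inter> P' = {}" using stop_eq[of \<Phi> x] stop_eq[of \<Phi> x'] assms P(3) by blast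
qed

text \<open>A cell is not an open cube, and \<open>x\<close> may lie on its boundary. Slightly
  larger open cubes contain the cell and compete in the supremum; then their half-side tends to that
  of the cell.\<close>

lemma cell_average_le_maxop:
  fixes f :: "'a \<Rightarrow> real"
  shows "(\<integral>\<^sup>+ y\<in>cell k x. ennreal \<bar>f y\<bar> \<partial>lebesgue) \<le> maxop f x * emeasure lebesgue (cell k x)"
proof (cases "maxop f x")
  case (real M)
  let ?r = "radius k" and ?n = "DIM('a)"
  have le: "(\<integral>\<^sup>+ y\<in>cell k x. ennreal \<bar>f y\<bar> \<partial>lebesgue) \<le> ennreal (M * (2 * s) ^ ?n)" if s: "?r < s" for s
  proof -
    have s0: "s > 0" using s radius_pos[of k] by linarith
    let ?Q = "open_cube (centre k x) s"
    have sub: "cell k x \<subseteq> ?Q" using s by (rule cell_subset_open_cube)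
    have "is_cube ?Q" using s0 by (auto simp: is_cube_iff_open_cube)
    moreover have "x \<in> ?Q" using sub cell_self by blast
    ultimately have "(\<integral>\<^sup>+ y\<in>?Q. ennreal \<bar>f y\<bar> \<partial>lebesgue) / emeasure lebesgue ?Q \<le> maxop f x"
      unfolding maxop_def by (intro SUP_upper) auto
    moreover have "emeasure lebesgue ?Q = ennreal ((2 * s)^?n)" using s0 by (simp add: emeasure_open_cube)
    ultimately have "(\<integral>\<^sup>+ y\<in>?Q. ennreal \<bar>f y\<bar> \<partial>lebesgue) / ennreal ((2 * s)^?n) \<le> ennreal M"
      using real by simp
    then have "(\<integral>\<^sup>+ y\<in>?Q. ennreal \<bar>f y\<bar> \<partial>lebesgue) \<le> ennreal M * ennreal ((2 * s)^?n)"
      using s0 by (intro ennreal_le_mult_of_divide_le) auto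
    then have "(\<integral>\<^sup>+ y\<in>?Q. ennreal \<bar>f y\<bar> \<partial>lebesgue) \<le> ennreal (M * (2 * s) ^ ?n)"
      using s0 real by (simp add: ennreal_mult)
    moreover have "(\<integral>\<^sup>+ y\<in>cell k x. ennreal \<bar>f y\<bar> \<partial>lebesgue) \<le> (\<integral>\<^sup>+ y\<in>?Q. ennreal \<bar>f y\<bar> \<partial>lebesgue)"
      using sub by (intro nn_integral_mono) (auto split: split_indicator)
    ultimately show ?thesis by (rule order_trans[rotated])
  qed
  have "((\<lambda>s. ennreal (M * (2 * s) ^ ?n)) \<longlongrightarrow> ennreal (M * (2 * ?r) ^ ?n)) (at_right ?r)"
    by (intro tendsto_intros)
  then have "(\<integral>\<^sup>+ y\<in>cell k x. ennreal \<bar>f y\<bar> \<partial>lebesgue) \<le> ennreal (M * (2 * ?r) ^ ?n)"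
  proof (rule tendsto_lowerbound)
    show "\<forall>\<^sub>F s in at_right ?r. (\<integral>\<^sup>+ y\<in>cell k x. ennreal \<bar>f y\<bar> \<partial>lebesgue) \<le> ennreal (M * (2 * s) ^ ?n)"
      using le by (auto simp: eventually_at_right_field intro: exI[of _ "?r + 1"])
  qed simp
  then show ?thesis using real radius_pos[of k] by (simp add: emeasure_cell ennreal_mult del: emeasure_completion)
next
  case top
  then show ?thesis using radius_pos[of k] by (simp add: emeasure_cell ennreal_top_mult del: emeasure_completion)
qed

end

section \<open>Consequences of the Fujii-Wilson condition\<close>

text \<open>The tail sum \<open>T j\<close> loses at least the proportion \<open>1/K\<close> when
  its first term is removed, so the tails decay geometrically, and \<open>a N\<close> is the last of
  them.\<close>

lemma geometric_decay:
  fixes a :: "nat \<Rightarrow> real"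
  assumes K: "K \<ge> 1" and tail: "\<And>j N. j \<le> N \<Longrightarrow> (\<Sum>i=j..N. a i) \<le> K * a j"
  shows "a N \<le> K * (1 - 1/K)^N * a 0"
proof -
  define T where "T j = (\<Sum>i=j..N. a i)" for j
  have "T j \<le> (1 - 1/K)^j * T 0" if "j \<le> N" for j
    using that
  proof (induction j)
    case (Suc j)
    have "T j = a j + T (Suc j)" using Suc.prems unfolding T_def by (intro sum.atLeast_Suc_atMost) simp
    moreover have "T j / K \<le> a j" using tail[of j N] Suc.prems K by (simp add: T_def field_simps)
    moreover have "(1 - 1/K) * T j = T j - T j / K" by (simp add: left_diff_distrib)
    ultimately have "T (Suc j) \<le> (1 - 1/K) * T j" by linarith
    also have "\<dots> \<le> (1 - 1/K) * ((1 - 1/K)^j * T 0)"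
      using Suc K by (intro mult_left_mono) auto
    finally show ?case by simp
  qed simp
  from this[of N] have "a N \<le> (1 - 1/K)^N * T 0" by (simp add: T_def)
  also have "\<dots> \<le> (1 - 1/K)^N * (K * a 0)"
    using tail[of 0 N] K unfolding T_def by (intro mult_left_mono) auto
  finally show ?thesis by (simp add: mult_ac)
qed

text \<open>The largest index satisfying \<open>b\<close> controls the whole sum, because the halved
  powers of 2 up to \<open>2^i\<close> add up to at most \<open>2^i\<close>.\<close>

lemma dyadic_layer_sum_le:
  fixes M :: ennreal
  assumes v: "v \<ge> 0" and b: "\<And>i. j \<le> i \<Longrightarrow> b i \<Longrightarrow> ennreal (2^i * v) \<le> M"
  shows "(\<Sum>i=j..<N. ennreal (2^i * v / 2) * (if b i then 1 else 0)) \<le> M"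
proof -
  have geo: "(\<Sum>i=j..<N. ennreal (2^i * v / 2)) \<le> ennreal (2^N * v / 2)" for N
  proof (induction N)
    case (Suc N)
    show ?case
    proof (cases "j \<le> N")
      case True
      then have "(\<Sum>i=j..<Suc N. ennreal (2^i * v / 2)) \<le> ennreal (2^N * v / 2) + ennreal (2^N * v / 2)"
        using Suc by (simp add: add_right_mono)
      also have "\<dots> = ennreal (2^Suc N * v / 2)" using v by (subst ennreal_plus[symmetric]) auto
      finally show ?thesis .
    qed simp
  qed simp
  show ?thesis
  proof (induction N)
    case (Suc N)
    show ?case
    proof (cases "j \<le> N \<and> b N")
      case True
      have "(\<Sum>i=j..<Suc N. ennreal (2^i * v / 2) * (if b i then 1 else 0)) \<le> (\<Sum>i=j..<Suc N. ennreal (2^i * v / 2))"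
        by (intro sum_mono) auto
      also have "\<dots> \<le> ennreal (2^Suc N * v / 2)" by (rule geo)
      also have "\<dots> \<le> M" using b[of N] True by simp
      finally show ?thesis .
    next
      case False
      then show ?thesis using Suc by (cases "j \<le> N") auto
    qed
  qed simp
qed

text \<open>The Fujii-Wilson condition with the denominator multiplied out, which also makes sense
  for cubes of zero mass.\<close>

locale fujii_wilson =
  fixes w :: "'a::euclidean_space \<Rightarrow> real" and A :: real
  assumes weight: "is_weight w" and A1: "A \<ge> 1"
    and maxop_integral: "is_cube Q \<Longrightarrow>
      (\<integral>\<^sup>+ x\<in>Q. maxop (\<lambda>y. w y * indicator Q y) x \<partial>lebesgue) \<le> ennreal A * emeasure (weighted w) Q"
begin

abbreviation W :: "'a measure" where "W \<equiv> weighted w"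

lemma w_measurable [measurable]: "w \<in> borel_measurable lebesgue"
  using weight by (rule weight_measurable)

lemma w_nonneg: "0 \<le> w x"
  using weight by (simp add: is_weight_def)

lemma W_null:
  assumes "N \<in> null_sets lebesgue"
  shows "emeasure W N = 0"
proof -
  have "absolutely_continuous lebesgue W" by (rule absolutely_continuousI_density) simp
  then show ?thesis using assms unfolding absolutely_continuous_def by blast
qed

end

section \<open>Level sets of the dyadic maximal function on a fixed cube\<close>

text \<open>\<open>v\<close> is the mean of \<open>w\<close> over the root cell \<open>Q\<close>,
  the reference value for all levels.\<close>

locale fujii_wilson_grid = fujii_wilson w A + dyadic_grid a l
  for w :: "'a::euclidean_space \<Rightarrow> real" and A and a :: 'a and l +
  fixes Q :: "'a set" and v :: real
  assumes Q: "Q = cell 0 (a + (l/2) *\<^sub>R One)" and v_pos: "v > 0"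
    and W_Q: "emeasure W Q = ennreal v * emeasure lebesgue Q"
begin

definition heavy :: "nat \<Rightarrow> 'a set \<Rightarrow> bool" where
  "heavy j S \<longleftrightarrow> ennreal (2^j * v) * emeasure lebesgue S < emeasure W S"

definition \<Omega> :: "nat \<Rightarrow> 'a set" where
  "\<Omega> j = {x\<in>Q. \<exists>k. heavy j (cell k x)}"

lemma heavy_antimono: "heavy i S \<Longrightarrow> j \<le> i \<Longrightarrow> heavy j S"
proof -
  assume i: "heavy i S" "j \<le> i"
  have "2^j * v \<le> 2^i * v" using v_pos i(2) by (intro mult_right_mono power_increasing) auto
  then have "ennreal (2^j * v) * emeasure lebesgue S \<le> ennreal (2^i * v) * emeasure lebesgue S"
    by (rule mult_right_mono[OF ennreal_leI]) simp
  with i(1) show ?thesis unfolding heavy_def by (rule le_less_trans[rotated])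
qed

lemma cell_0: "x \<in> Q \<Longrightarrow> cell 0 x = Q"
  unfolding Q by (rule cell_eq)

lemma \<Omega>_antimono: "j \<le> i \<Longrightarrow> \<Omega> i \<subseteq> \<Omega> j"
  unfolding \<Omega>_def using heavy_antimono by blast

lemma stop_subset_\<Omega>:
  assumes "x \<in> \<Omega> j"
  shows "stop (heavy j) x \<subseteq> \<Omega> j"
proof
  fix y assume y: "y \<in> stop (heavy j) x"
  have x: "\<exists>k. heavy j (cell k x)" "x \<in> Q" using assms by (auto simp: \<Omega>_def)
  have "heavy j (stop (heavy j) y)" using stop_eq[OF x(1) y] stop_sat[OF x(1)] by simp
  then have "\<exists>k. heavy j (cell k y)" unfolding stop_def by blast
  moreover have "y \<in> cell 0 x" using y cell_antimono[of 0] unfolding stop_def by blast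
  ultimately show "y \<in> \<Omega> j" using cell_0[OF x(2)] by (simp add: \<Omega>_def)
qed

lemma \<Omega>_eq: "\<Omega> j = (\<Union>P\<in>stop (heavy j) ` \<Omega> j. P)"
  using stop_subset_\<Omega> stop_self by blast

lemma \<Omega>_lebesgue [measurable]: "\<Omega> j \<in> sets lebesgue"
  by (subst \<Omega>_eq) (intro sets.countable_UN' countable_stop, auto simp: stop_lebesgue)

lemma disjoint_stop_\<Omega>: "disjoint_family_on (\<lambda>P. P) (stop (heavy j) ` \<Omega> j)"
  by (rule disjoint_stop) (simp add: \<Omega>_def)

text \<open>The root is not heavy, so the stopping cell has a parent; by minimality the parent is
  not heavy either, and its volume is only \<open>2^DIM('a)\<close> times as large.\<close>

lemma W_stop_le:
  assumes x: "x \<in> \<Omega> j"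
  shows "emeasure W (stop (heavy j) x) \<le> ennreal (2^DIM('a) * (2^j * v)) * emeasure lebesgue (stop (heavy j) x)"
proof -
  define m where "m = (LEAST k. heavy j (cell k x))"
  have xQ: "x \<in> Q" using x by (simp add: \<Omega>_def)
  have "heavy j (cell m x)" unfolding m_def by (rule LeastI_ex) (use x in \<open>simp add: \<Omega>_def\<close>)
  moreover have "\<not> heavy j Q"
  proof -
    have "1 * v \<le> 2^j * v" using v_pos by (intro mult_right_mono) auto
    then have "emeasure W Q \<le> ennreal (2^j * v) * emeasure lebesgue Q"
      unfolding W_Q by (intro mult_right_mono ennreal_leI) auto
    then show ?thesis by (simp add: heavy_def not_less)
  qed
  ultimately have "m \<noteq> 0" using cell_0[OF xQ] by (metis)
  then obtain p where p: "m = Suc p" by (cases m) auto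
  have "\<not> heavy j (cell p x)" using not_less_Least[of p "\<lambda>k. heavy j (cell k x)"] p unfolding m_def by simp
  then have "emeasure W (cell p x) \<le> ennreal (2^j * v) * emeasure lebesgue (cell p x)"
    by (simp add: heavy_def not_less)
  also have "emeasure lebesgue (cell p x) = ennreal (2^DIM('a)) * emeasure lebesgue (cell m x)"
  proof -
    have "2 * radius p = 2 * (2 * radius m)" by (simp add: radius_def p)
    then have "(2 * radius p)^DIM('a) = 2^DIM('a) * (2 * radius m)^DIM('a)"
      by (metis power_mult_distrib)
    then show ?thesis using radius_pos[of m] by (simp only: emeasure_cell) (simp add: ennreal_mult)
  qed
  finally have "emeasure W (cell p x) \<le> ennreal (2^DIM('a) * (2^j * v)) * emeasure lebesgue (cell m x)"
    using v_pos by (simp add: ennreal_mult mult_ac del: emeasure_completion)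
  moreover have "emeasure W (cell m x) \<le> emeasure W (cell p x)"
    by (intro emeasure_mono cell_antimono) (auto simp: p)
  ultimately show ?thesis unfolding stop_def m_def[symmetric] by (rule order_trans[rotated])
qed

lemma W_\<Omega>_le: "emeasure W (\<Omega> j) \<le> ennreal (2^DIM('a) * (2^j * v)) * emeasure lebesgue (\<Omega> j)"
proof -
  have "emeasure W (\<Union>P\<in>stop (heavy j) ` \<Omega> j. P) \<le> ennreal (2^DIM('a) * (2^j * v)) * emeasure lebesgue (\<Omega> j)"
    by (rule emeasure_UN_le_disjoint[OF countable_stop, where Y = "\<lambda>P. P"])
       (use W_stop_le disjoint_stop_\<Omega> \<Omega>_eq in \<open>auto simp: stop_lebesgue simp del: emeasure_completion\<close>)
  then show ?thesis using \<Omega>_eq by metis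
qed

text \<open>
  A point of \<open>\<Omega> i\<close> in a stopping cell \<open>P\<close> of level \<open>j \<le> i\<close> lies in a heavy cell contained in
  \<open>P\<close>, so the maximal function of \<open>w\<close> localised to \<open>P\<close> is at least \<open>2\<^sup>i v\<close> there.
  The factor \<open>1/2\<close> absorbs the geometric series; it stands on this side because \<open>maxop\<close> is then never
  multiplied by a constant under the integral, which would require its measurability.
\<close>

lemma layer_stop_le:
  assumes x: "x \<in> \<Omega> j"
  shows "(\<integral>\<^sup>+ y\<in>stop (heavy j) x. (\<Sum>i=j..<N. ennreal (2^i * v / 2) * indicator (\<Omega> i) y) \<partial>lebesgue)
    \<le> ennreal A * emeasure W (stop (heavy j) x)"
proof -
  define P where "P = stop (heavy j) x"
  define m where "m = (LEAST k. heavy j (cell k x))"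
  \<comment> \<open>The Fujii-Wilson bound is stated for open cubes, so it is applied to the open
    cube inside \<open>P\<close>, which differs from \<open>P\<close> by a null set.\<close>
  define C where "C = open_cube (centre m x) (radius m)"
  define f where "f y = w y * indicator C y" for y
  define g where "g y = (\<Sum>i=j..<N. ennreal (2^i * v / 2) * indicator (\<Omega> i) y)" for y
  have Pm: "P = cell m x" by (simp add: P_def m_def stop_def)
  have C: "C \<subseteq> P" "C \<in> sets lebesgue" and null: "P - C \<in> null_sets lebesgue"
    unfolding Pm C_def by (rule open_cube_subset_cell, simp, rule cell_diff_open_cube_null)
  have xe: "\<exists>k. heavy j (cell k x)" using x by (simp add: \<Omega>_def)
  have g_le: "g y \<le> maxop f y" if y: "y \<in> C" for y
  proof -
    have lev: "ennreal (2^i * v) \<le> maxop f y" if i: "j \<le> i" "y \<in> \<Omega> i" for i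
    proof (rule ccontr)
      assume "\<not> ennreal (2^i * v) \<le> maxop f y"
      then have less: "maxop f y \<le> ennreal (2^i * v)" by simp
      obtain k where k: "heavy i (cell k y)" using i by (auto simp: \<Omega>_def)
      have "cell k y \<subseteq> stop (heavy j) y" using heavy_antimono[OF k i(1)] by (rule cell_subset_stop)
      also have "\<dots> = P" unfolding P_def using xe y C(1) P_def by (intro stop_eq) auto
      finally have sub: "cell k y \<subseteq> P" .
      have "emeasure W (cell k y) \<le> emeasure W ((cell k y \<inter> C) \<union> (P - C))"
        using sub C by (intro emeasure_mono) (auto simp: Pm intro!: sets.Un sets.Int sets.Diff)
      also have "\<dots> \<le> emeasure W (cell k y \<inter> C) + emeasure W (P - C)"
        using C by (intro emeasure_subadditive) (auto simp: Pm intro!: sets.Int sets.Diff)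
      also have "\<dots> = emeasure W (cell k y \<inter> C)" using W_null[OF null] by simp
      also have "\<dots> = (\<integral>\<^sup>+ z. ennreal (w z) * indicator (cell k y \<inter> C) z \<partial>lebesgue)"
        using C by (subst emeasure_density) auto
      also have "\<dots> = (\<integral>\<^sup>+ z\<in>cell k y. ennreal \<bar>f z\<bar> \<partial>lebesgue)"
        by (intro nn_integral_cong) (auto simp: f_def w_nonneg split: split_indicator)
      also have "\<dots> \<le> maxop f y * emeasure lebesgue (cell k y)" by (rule cell_average_le_maxop)
      also have "\<dots> \<le> ennreal (2^i * v) * emeasure lebesgue (cell k y)" using less by (rule mult_right_mono) simp
      also have "\<dots> < emeasure W (cell k y)" using k by (simp only: heavy_def)
      finally show False by simp
    qed
    have "g y = (\<Sum>i=j..<N. ennreal (2^i * v / 2) * (if y \<in> \<Omega> i then 1 else 0))"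
      unfolding g_def by (intro sum.cong) (auto simp: indicator_def)
    also have "\<dots> \<le> maxop f y" using v_pos lev by (intro dyadic_layer_sum_le) auto
    finally show ?thesis .
  qed
  have "AE y in lebesgue. y \<notin> P - C" using null by (rule AE_not_in)
  then have "(\<integral>\<^sup>+ y\<in>P. g y \<partial>lebesgue) = (\<integral>\<^sup>+ y\<in>C. g y \<partial>lebesgue)"
    using C(1) by (intro nn_integral_cong_AE) (auto split: split_indicator elim!: eventually_mono)
  also have "\<dots> \<le> (\<integral>\<^sup>+ y\<in>C. maxop f y \<partial>lebesgue)"
    using g_le by (intro nn_integral_mono) (auto split: split_indicator)
  also have "\<dots> \<le> ennreal A * emeasure W C"
    unfolding f_def using radius_pos by (intro maxop_integral) (auto simp: is_cube_iff_open_cube C_def)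
  also have "\<dots> \<le> ennreal A * emeasure W P"
    using C(1) by (intro mult_left_mono emeasure_mono) (auto simp: Pm)
  finally show ?thesis by (simp add: g_def P_def)
qed

text \<open>Sums the local estimate over the disjoint stopping cells of level \<open>j\<close>,
  outside of which all layers \<open>\<Omega> i\<close> with \<open>i \<ge> j\<close> are empty. The
  factor \<open>A\<close> comes from the maximal function, \<open>2^DIM('a)\<close> from the parent
  cells.\<close>

lemma layer_\<Omega>_le:
  "(\<Sum>i=j..<N. ennreal (2^i * v / 2) * emeasure lebesgue (\<Omega> i))
    \<le> ennreal (A * 2^DIM('a) * (2^j * v)) * emeasure lebesgue (\<Omega> j)"
proof -
  define g where "g y = (\<Sum>i=j..<N. ennreal (2^i * v / 2) * indicator (\<Omega> i) y)" for y
  have g [measurable]: "g \<in> borel_measurable lebesgue" unfolding g_def by measurable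
  have "(\<Sum>i=j..<N. ennreal (2^i * v / 2) * emeasure lebesgue (\<Omega> i)) =
    (\<Sum>i=j..<N. (\<integral>\<^sup>+ y. ennreal (2^i * v / 2) * indicator (\<Omega> i) y \<partial>lebesgue))"
    by (intro sum.cong) (auto simp: nn_integral_cmult_indicator simp del: emeasure_completion)
  also have "\<dots> = (\<integral>\<^sup>+ y. g y \<partial>lebesgue)"
    unfolding g_def by (intro nn_integral_sum[symmetric]) auto
  also have "\<dots> = (\<integral>\<^sup>+ y\<in>\<Omega> j. g y \<partial>lebesgue)"
  proof (intro nn_integral_cong)
    fix y
    have "g y = 0" if "y \<notin> \<Omega> j"
      unfolding g_def using that \<Omega>_antimono[THEN subsetD, of j _ y] by (intro sum.neutral) (auto simp: indicator_def)
    then show "g y = g y * indicator (\<Omega> j) y" by (auto split: split_indicator)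
  qed
  \<comment> \<open>Read as a measure with density \<open>g\<close>, the integral can be split over
    the stopping cells.\<close>
  also have "\<dots> = emeasure (density lebesgue g) (\<Union>P\<in>stop (heavy j) ` \<Omega> j. P)"
    unfolding \<Omega>_eq[symmetric] by (subst emeasure_density) auto
  also have "\<dots> \<le> ennreal (A * 2^DIM('a) * (2^j * v)) * emeasure lebesgue (\<Omega> j)"
  proof (rule emeasure_UN_le_disjoint[OF countable_stop, where Y = "\<lambda>P. P"])
    fix P assume "P \<in> stop (heavy j) ` \<Omega> j"
    then obtain x where x: "x \<in> \<Omega> j" "P = stop (heavy j) x" by blast
    show "P \<in> sets (density lebesgue g)" "P \<in> sets lebesgue" by (simp_all add: x stop_lebesgue)
    have "emeasure (density lebesgue g) P = (\<integral>\<^sup>+ y\<in>P. g y \<partial>lebesgue)"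
      by (subst emeasure_density) (auto simp: x stop_lebesgue)
    also have "\<dots> \<le> ennreal A * emeasure W P" unfolding g_def x(2) using x(1) by (rule layer_stop_le)
    also have "\<dots> \<le> ennreal A * (ennreal (2^DIM('a) * (2^j * v)) * emeasure lebesgue P)"
      unfolding x(2) using x(1) by (intro mult_left_mono W_stop_le) auto
    also have "\<dots> = ennreal (A * 2^DIM('a) * (2^j * v)) * emeasure lebesgue P"
      using A1 v_pos by (simp add: ennreal_mult mult_ac del: emeasure_completion)
    finally show "emeasure (density lebesgue g) P \<le> ennreal (A * 2^DIM('a) * (2^j * v)) * emeasure lebesgue P" .
  qed (use disjoint_stop_\<Omega> \<Omega>_eq in auto)
  finally show ?thesis .
qed

lemma Q_lebesgue: "Q \<in> sets lebesgue"
  by (simp add: Q)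

lemma emeasure_Q: "emeasure lebesgue Q = ennreal (l ^ DIM('a))"
  unfolding Q emeasure_cell by (simp add: radius_def)

text \<open>The layer estimate is the tail condition for the numbers \<open>2^j * v * d j\<close>,
  with \<open>d j\<close> the Lebesgue measure of \<open>\<Omega> j\<close>; the extra factor 2 in
  \<open>K\<close> undoes the halved coefficients. \<open>W_\<Omega>_le\<close> converts the decay
  into one of \<open>W\<close>-mass.\<close>

lemma W_\<Omega>_decay:
  assumes K: "K = A * 2^(DIM('a) + 1)"
  shows "emeasure W (\<Omega> j) \<le> ennreal (2^DIM('a) * K * (1 - 1/K)^j) * emeasure W Q"
proof -
  have le: "emeasure lebesgue (\<Omega> i) \<le> ennreal (l ^ DIM('a))" for i
    using emeasure_mono[of "\<Omega> i" Q lebesgue] Q_lebesgue by (auto simp: \<Omega>_def emeasure_Q simp del: emeasure_completion)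
  define d where "d i = measure lebesgue (\<Omega> i)" for i
  have d: "emeasure lebesgue (\<Omega> i) = ennreal (d i)" for i
    unfolding d_def using le[of i] by (intro emeasure_eq_ennreal_measure) (auto simp: top_unique simp del: emeasure_completion)
  have d0: "d i \<ge> 0" for i by (simp add: d_def)
  have "(1::real) \<le> 2^(DIM('a) + 1)" by (rule one_le_power) simp
  then have "1 * 1 \<le> A * 2^(DIM('a) + 1)" using A1 by (intro mult_mono) auto
  then have K1: "K \<ge> 1" using K by simp
  have "2^j * v * d j \<le> K * (1 - 1/K)^j * (2^0 * v * d 0)"
  proof (rule geometric_decay[OF K1])
    fix i N :: nat assume "i \<le> N"
    have "ennreal (\<Sum>k=i..<Suc N. 2^k * v / 2 * d k) \<le> ennreal (A * 2^DIM('a) * (2^i * v) * d i)"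
      using layer_\<Omega>_le[of i "Suc N"] v_pos d0 A1
      by (simp only: d) (simp add: ennreal_mult[symmetric] sum_ennreal del: sum.op_ivl_Suc)
    then have "(\<Sum>k=i..<Suc N. 2^k * v / 2 * d k) \<le> A * 2^DIM('a) * (2^i * v) * d i"
      using v_pos d0 A1 by (subst (asm) ennreal_le_iff) auto
    also have "(\<Sum>k=i..<Suc N. 2^k * v / 2 * d k) = (\<Sum>k=i..N. 2^k * v * d k) / 2"
      by (simp add: sum_divide_distrib atLeastLessThanSuc_atLeastAtMost del: sum.op_ivl_Suc)
    finally show "(\<Sum>k=i..N. 2^k * v * d k) \<le> K * (2^i * v * d i)" by (simp add: K mult_ac)
  qed
  also have "\<dots> \<le> K * (1 - 1/K)^j * (v * l ^ DIM('a))"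
  proof -
    have "d 0 \<le> l ^ DIM('a)" using le[of 0] l_pos unfolding d by (subst (asm) ennreal_le_iff) auto
    then show ?thesis using v_pos K1 by (intro mult_left_mono) auto
  qed
  finally have *: "2^j * v * d j \<le> K * (1 - 1/K)^j * (v * l ^ DIM('a))" .
  have "emeasure W (\<Omega> j) \<le> ennreal (2^DIM('a) * (2^j * v)) * ennreal (d j)"
    using W_\<Omega>_le[of j] unfolding d .
  also have "\<dots> = ennreal (2^DIM('a) * (2^j * v * d j))" using d0 v_pos by (simp add: ennreal_mult mult_ac)
  also have "\<dots> \<le> ennreal (2^DIM('a) * (K * (1 - 1/K)^j * (v * l ^ DIM('a))))"
    using * by (intro ennreal_leI mult_left_mono) auto
  also have "\<dots> = ennreal (2^DIM('a) * K * (1 - 1/K)^j) * emeasure W Q"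
    unfolding W_Q emeasure_Q using K1 v_pos l_pos by (simp add: ennreal_mult mult_ac)
  finally show ?thesis .
qed

text \<open>
  An outer open set cut into cells replaces the Lebesgue differentiation theorem.
\<close>

lemma W_diff_\<Omega>_le:
  assumes F: "F \<in> sets lebesgue" "F \<subseteq> Q"
  shows "emeasure W (F - \<Omega> j) \<le> ennreal (2^j * v) * emeasure lebesgue F"
proof -
  have bound: "emeasure W (F - \<Omega> j) \<le> ennreal (2^j * v) * emeasure lebesgue U" if U: "open U" "F \<subseteq> U" for U
  proof -
    define \<Phi> where "\<Phi> S \<longleftrightarrow> S \<subseteq> U" for S
    have ex: "\<exists>k. \<Phi> (cell k x)" if "x \<in> F - \<Omega> j" for x
      unfolding \<Phi>_def using cell_subset_open[OF U(1), of x] that U(2) by blast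
    have "emeasure W (F - \<Omega> j) \<le> emeasure W (\<Union>P\<in>stop \<Phi> ` (F - \<Omega> j). P)"
    proof (rule emeasure_mono)
      show "F - \<Omega> j \<subseteq> (\<Union>P\<in>stop \<Phi> ` (F - \<Omega> j). P)" using stop_self by blast
      show "(\<Union>P\<in>stop \<Phi> ` (F - \<Omega> j). P) \<in> sets W"
        by (intro sets.countable_UN' countable_stop) (auto simp: stop_lebesgue)
    qed
    also have "\<dots> \<le> ennreal (2^j * v) * emeasure lebesgue U"
    proof (rule emeasure_UN_le_disjoint[OF countable_stop, where Y = "\<lambda>P. P"])
      show "disjoint_family_on (\<lambda>P. P) (stop \<Phi> ` (F - \<Omega> j))" using ex by (rule disjoint_stop)
      show "U \<in> sets lebesgue" using U(1) borel_open by auto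
      show "(\<Union>P\<in>stop \<Phi> ` (F - \<Omega> j). P) \<subseteq> U"
        using stop_sat[OF ex] unfolding \<Phi>_def by blast
      fix P assume "P \<in> stop \<Phi> ` (F - \<Omega> j)"
      then obtain x where x: "x \<in> F - \<Omega> j" "P = stop \<Phi> x" by blast
      show "P \<in> sets W" "P \<in> sets lebesgue" by (simp_all add: x stop_lebesgue)
      \<comment> \<open>Outside \<open>\<Omega> j\<close> no cell at \<open>x\<close> is heavy, so
        neither is the maximal cell inside \<open>U\<close>.\<close>
      have "x \<in> Q" "\<nexists>k. heavy j (cell k x)" using x F(2) by (auto simp: \<Omega>_def)
      then show "emeasure W P \<le> ennreal (2^j * v) * emeasure lebesgue P"
        unfolding x(2) stop_def heavy_def by (simp add: not_less del: emeasure_completion)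
    qed
    finally show ?thesis .
  qed
  have finF: "emeasure lebesgue F < \<infinity>"
    using emeasure_mono[OF F(2) Q_lebesgue] by (auto simp: emeasure_Q less_top[symmetric] top_unique simp del: emeasure_completion)
  show ?thesis
  proof (rule ennreal_le_epsilon)
    fix e :: real assume e: "e > 0"
    define e' where "e' = e / (2^j * v)"
    have e': "e' > 0" using e v_pos by (simp add: e'_def)
    obtain U where U: "open U" "F \<subseteq> U" "U - F \<in> lmeasurable" "emeasure lebesgue (U - F) < ennreal e'"
      by (rule sets_lebesgue_outer_open[OF F(1) e'])
    have "F \<union> (U - F) = U" using U(2) by blast
    then have "emeasure lebesgue U = emeasure lebesgue F + emeasure lebesgue (U - F)"
      using plus_emeasure[OF F(1) fmeasurableD[OF U(3)]] by simp
    also have "\<dots> \<le> emeasure lebesgue F + ennreal e'" using U(4) by (intro add_left_mono) simp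
    finally have "ennreal (2^j * v) * emeasure lebesgue U \<le> ennreal (2^j * v) * (emeasure lebesgue F + ennreal e')"
      by (rule mult_left_mono) simp
    also have "\<dots> = ennreal (2^j * v) * emeasure lebesgue F + ennreal e"
      using e' v_pos by (simp add: distrib_left ennreal_mult[symmetric] e'_def del: emeasure_completion)
    finally show "emeasure W (F - \<Omega> j) \<le> ennreal (2^j * v) * emeasure lebesgue F + ennreal e"
      using bound[OF U(1,2)] by (rule order_trans[rotated])
  qed
qed

text \<open>Splits \<open>F\<close> along \<open>\<Omega> j\<close>: outside, \<open>w\<close> is in
  effect at most \<open>2^j * v\<close>; inside, the decay of the level sets takes over.\<close>

lemma W_subset_le:
  assumes F: "F \<in> sets lebesgue" "F \<subseteq> Q" and t: "0 \<le> t" "emeasure lebesgue F \<le> ennreal t * emeasure lebesgue Q"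
    and K: "K = A * 2^(DIM('a) + 1)"
  shows "emeasure W F \<le> ennreal (2^j * t + 2^DIM('a) * K * (1 - 1/K)^j) * emeasure W Q"
proof -
  have K1: "1 \<le> K"
  proof -
    have "(1::real) \<le> 2^(DIM('a) + 1)" by (rule one_le_power) simp
    then have "1 * 1 \<le> A * 2^(DIM('a) + 1)" using A1 by (intro mult_mono) auto
    then show ?thesis using K by simp
  qed
  have "emeasure W F \<le> emeasure W ((F - \<Omega> j) \<union> \<Omega> j)" using F(1) by (intro emeasure_mono) auto
  also have "\<dots> \<le> emeasure W (F - \<Omega> j) + emeasure W (\<Omega> j)" using F(1) by (intro emeasure_subadditive) auto
  also have "\<dots> \<le> ennreal (2^j * v) * (ennreal t * emeasure lebesgue Q) + ennreal (2^DIM('a) * K * (1 - 1/K)^j) * emeasure W Q"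
    by (intro add_mono W_\<Omega>_decay[OF K] order_trans[OF W_diff_\<Omega>_le[OF F]] mult_left_mono t(2)) simp
  also have "ennreal (2^j * v) * (ennreal t * emeasure lebesgue Q) = ennreal (2^j * t) * emeasure W Q"
    unfolding W_Q using v_pos t(1) by (simp add: ennreal_mult mult_ac del: emeasure_completion)
  also have "ennreal (2^j * t) * emeasure W Q + ennreal (2^DIM('a) * K * (1 - 1/K)^j) * emeasure W Q =
      ennreal (2^j * t + 2^DIM('a) * K * (1 - 1/K)^j) * emeasure W Q"
    using t(1) K1 by (subst ennreal_plus) (auto simp: distrib_right)
  finally show ?thesis .
qed

end

section \<open>From the class \<open>A_infty\<close> to the power bound and the theorem\<close>

lemma A_infty_fujii_wilson:
  assumes "w \<in> A_infty"
  shows "\<exists>A. fujii_wilson w A"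
proof -
  have w: "is_weight w" and fin: "Ainf_const w < \<infinity>" using assms by (auto simp: A_infty_def)
  define A where "A = max 1 (enn2real (Ainf_const w))"
  have "Ainf_const w = ennreal (enn2real (Ainf_const w))" using fin by simp
  also have "\<dots> \<le> ennreal A" unfolding A_def by (intro ennreal_leI) simp
  finally have le: "Ainf_const w \<le> ennreal A" .
  have "fujii_wilson w A"
  proof
    show "is_weight w" by fact
    show "1 \<le> A" by (simp add: A_def)
    fix Q :: "'a set" assume Q: "is_cube Q"
    then obtain c r where cr: "Q = open_cube c r" by (auto simp: is_cube_iff_open_cube)
    define X where "X = (\<integral>\<^sup>+ x\<in>Q. maxop (\<lambda>y. w y * indicator Q y) x \<partial>lebesgue)"
    have "X / wmeas w Q \<le> Ainf_const w"
      unfolding Ainf_const_def X_def using Q by (intro SUP_upper) auto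
    then have *: "X / emeasure (weighted w) Q \<le> ennreal A"
      using le by (simp add: wmeas_eq_emeasure[OF w] cr)
    have "X \<le> ennreal A * emeasure (weighted w) Q"
    proof (cases "emeasure (weighted w) Q = 0")
      case True
      \<comment> \<open>A nonzero \<open>X\<close> divided by 0 would be infinite.\<close>
      then have "X = 0" using * by (auto simp: top_unique split: if_splits)
      then show ?thesis by simp
    next
      case False
      then show ?thesis
        using * emeasure_weighted_open_cube_finite[OF w, of c r] cr by (intro ennreal_le_mult_of_divide_le) auto
    qed
    then show "(\<integral>\<^sup>+ x\<in>Q. maxop (\<lambda>y. w y * indicator Q y) x \<partial>lebesgue) \<le> ennreal A * emeasure (weighted w) Q"
      by (simp add: X_def)
  qed
  then show ?thesis ..
qed

text \<open>Each open cube is, up to a null set, the root cell of its own grid, so the estimate for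
  root cells transfers with constants independent of the cube.\<close>

lemma fujii_wilson_power_bounded:
  fixes w :: "'a::euclidean_space \<Rightarrow> real"
  assumes "fujii_wilson w A"
  shows "\<exists>C \<theta>. power_bounded_measure (weighted w) C \<theta>"
proof -
  interpret fujii_wilson w A by fact
  define K where "K = A * 2^(DIM('a) + 1)"
  have "(2::real)^1 \<le> 2^(DIM('a) + 1)" by (rule power_increasing) auto
  then have "1 * 2 \<le> A * 2^(DIM('a) + 1)" using A1 by (intro mult_mono) auto
  \<comment> \<open>This yields the lower bound 1/2 for \<open>\<theta> = 1 - 1/K\<close>.\<close>
  then have K2: "2 \<le> K" by (simp add: K_def)
  have "power_bounded_measure W (2^DIM('a) * K) (1 - 1/K)"
  proof
    show "sets W = sets lebesgue" by simp
    show "0 < 2^DIM('a) * K" "1/2 \<le> 1 - 1/K" "1 - 1/K < 1" using K2 by (auto simp: field_simps)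
    show "emeasure W (open_cube c r) < \<infinity>" for c r using weight by (rule emeasure_weighted_open_cube_finite)
    fix F :: "'a set" and c :: 'a and r t :: real and j :: nat
    assume F: "F \<in> sets lebesgue" "F \<subseteq> open_cube c r" and r: "r > 0" and t: "0 \<le> t"
      "emeasure lebesgue F \<le> ennreal t * emeasure lebesgue (open_cube c r)"
    define a where "a = c - r *\<^sub>R One"
    interpret dyadic_grid a "2 * r" by unfold_locales (use r in simp)
    define Q where "Q = cell 0 (a + (2 * r / 2) *\<^sub>R One)"
    have c: "centre 0 (a + (2 * r / 2) *\<^sub>R One) = c" unfolding centre_0 by (simp add: a_def)
    have rad: "radius 0 = r" by (simp add: radius_def)
    have sub: "open_cube c r \<subseteq> Q" using open_cube_subset_cell[of 0 "a + (2 * r / 2) *\<^sub>R One"] unfolding c rad Q_def .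
    have null: "Q - open_cube c r \<in> null_sets lebesgue"
      using cell_diff_open_cube_null[of 0 "a + (2 * r / 2) *\<^sub>R One"] unfolding c rad Q_def .
    have Q: "Q \<in> sets lebesgue" by (simp add: Q_def)
    have leb: "emeasure lebesgue Q = ennreal ((2 * r)^DIM('a))" unfolding Q_def emeasure_cell rad ..
    have "emeasure W Q = emeasure W (open_cube c r \<union> (Q - open_cube c r))"
      using sub by (intro arg_cong2[where f=emeasure]) auto
    also have "\<dots> \<le> emeasure W (open_cube c r) + emeasure W (Q - open_cube c r)"
      using Q by (intro emeasure_subadditive) (auto intro!: sets.Diff)
    also have "\<dots> = emeasure W (open_cube c r)" using W_null[OF null] by simp
    finally have WQ: "emeasure W Q \<le> emeasure W (open_cube c r)" .
    show "emeasure W F \<le> ennreal (2^j * t + 2^DIM('a) * K * (1 - 1/K)^j) * emeasure W (open_cube c r)"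
    proof (cases "emeasure W Q = 0")
      \<comment> \<open>Without mass the mean would be 0 and the grid locale could not be
        entered.\<close>
      case True
      then have "emeasure W F = 0" using emeasure_mono[of F Q W] F sub Q by auto
      then show ?thesis by simp
    next
      case False
      define v where "v = measure W Q / (2 * r)^DIM('a)"
      have "emeasure W Q < \<infinity>" using WQ emeasure_weighted_open_cube_finite[OF weight] by (rule le_less_trans)
      then have m: "emeasure W Q = ennreal (measure W Q)" by (intro emeasure_eq_ennreal_measure) simp
      then have "measure W Q \<noteq> 0" using False by auto
      then have "measure W Q > 0" by (simp add: zero_less_measure_iff)
      then have v: "v > 0" using r by (simp add: v_def)
      interpret fujii_wilson_grid w A a "2 * r" Q v
      proof
        show "Q = cell 0 (a + (2 * r / 2) *\<^sub>R One)" by (rule Q_def)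
        show "0 < v" by (rule v)
        show "emeasure W Q = ennreal v * emeasure lebesgue Q"
          unfolding m leb using v r by (simp add: ennreal_mult[symmetric]) (simp add: v_def)
      qed
      have "emeasure W F \<le> ennreal (2^j * t + 2^DIM('a) * K * (1 - 1/K)^j) * emeasure W Q"
        using F sub t r by (intro W_subset_le[OF _ _ _ _ K_def]) (auto simp: leb emeasure_open_cube)
      also have "\<dots> \<le> ennreal (2^j * t + 2^DIM('a) * K * (1 - 1/K)^j) * emeasure W (open_cube c r)"
        using WQ by (rule mult_left_mono) simp
      finally show ?thesis .
    qed
  qed
  then show ?thesis by blast
qed

theorem theorem1p1:
  fixes w :: "'a::euclidean_space \<Rightarrow> real"
  assumes "w \<in> A_infty"
  shows "\<exists>C c. C > 0 \<and> c > 0 \<and>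
    (\<forall>\<^sub>F \<alpha> in at_left 1. tauberian w \<alpha> \<le> ennreal (1 + C * (1 - \<alpha>) powr c))"
proof -
  have w: "is_weight w" using assms by (simp add: A_infty_def)
  show ?thesis
    using A_infty_fujii_wilson[OF assms] fujii_wilson_power_bounded tauberian_le_of_power_bounded[OF w]
    by blast
qed

end
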